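(* Let $N\ge 3$ be odd, $q=e^{\pi \mathbf{i}/N}$ and $a\in\mathbb{C}\setminus\{0\}$. For every $i\in\{0,1,\dots,N-1\}$ and every $Z\in U_q(sl_2)$, the image of $R$ in the semicyclic representation $\rho_{a,i}$ satisfies $$(\rho_{a,i}\otimes\rho_{a,i})\left(R\,\Delta(Z)\,R^{-1}\right)=(\rho_{a,i}\otimes\rho_{a,i})\left(\Delta'(Z)\right).$$
   Context: Throughout, $\mathbf{i}=\sqrt{-1}$, $N\ge3$ is odd, $q=e^{\pi\mathbf{i}/N}$, $[l]=\frac{q^l-q^{-l}}{q-q^{-1}}$, $[0]!=1$, $[n]!=[n][n-1]!$. $U_q(sl_2)$ is the complex algebra generated by $K,K^{-1},E,F$ with $KK^{-1}=K^{-1}K=1$, $KE=q^2EK$, $KF=q^{-2}FK$, $EF-FE=\frac{K-K^{-1}}{q-q^{-1}}$. Its comultiplication is $\Delta(K)=K\otimes K$, $\Delta(E)=E\otimes K+1\otimes E$, $\Delta(F)=F\otimes1+K^{-1}\otimes F$; $\Delta'=\sigma\circ\Delta$ with $\sigma(x\otimes y)=y\otimes x$ is the flipped comultiplication. Semicyclic representations: let $V$ have basis $v_0,\dots,v_{N-1}$. For $m\in\mathbb{Z}$ let $\overline m\in\{0,\dots,N-1\}$ be its remainder mod $N$. For $a\in\mathbb{C}\setminus\{0\}$ and $i\in\{0,\dots,N-1\}$, the representation $\rho_{a,i}:U_q(sl_2)\to \mathrm{End}(V)=M_N(\mathbb{C})$ is given by $\rho_{a,i}(K)v_k=q^{1-N+2(k-i)}v_k$;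 $\rho_{a,i}(E)v_k=v_{k+1}$ for $k<N-1$ and $\rho_{a,i}(E)v_{N-1}=a v_0$; and for $k\in\{0,\dots,N-1\}$, $\rho_{a,i}(F)v_{\overline{i+k}}=[k][N-k]\,v_{\overline{i+k-1}}$ if $\overline{i+k}\ne0$, and $\rho_{a,i}(F)v_{\overline{i+k}}=\frac{[k][N-k]}{a}\,v_{\overline{i+k-1}}$ if $\overline{i+k}=0$. (Thus $\rho_{a,i}(E)^N=a\,\mathrm{Id}$, $\rho_{a,i}(F)^N=0$, $\rho_{a,i}(K)^N=\mathrm{Id}$.) $R$-matrix: formally $R=q^{\frac{H\otimes H}{2}}\sum_{l=0}^{N-1}\frac{(q-q^{-1})^l}{[l]!}q^{\frac{l(l-1)}{2}}E^l\otimes F^l$ with $K=q^H$. Its image in $\rho_{a,i}\otimes\rho_{a,i}$ is the operator on $V\otimes V$ obtained by replacing $E,F$ by $\rho_{a,i}(E),\rho_{a,i}(F)$ and letting $q^{\frac{H\otimes H}{2}}$ act by $v_j\otimes v_k\mapsto q^{h_jh_k/2}\,v_j\otimes v_k$ with $h_k=1-N+2(k-i)$. The expression $(\rho_{a,i}\otimes\rho_{a,i})(R\Delta(Z)R^{-1})$ means the product of the images of $R$, $\Delta(Z)$ and the inverse operator of the image of $R$. *)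

theory Defs
  imports
    Complex_Main
    "HOL-Algebra.QuotRing"
    "HOL-Algebra.Module"
    "HOL-Library.Poly_Mapping"
    "Jordan_Normal_Form.Matrix"
begin

section \<open>Complex algebras by generators and relations\<close>

text \<open>
  A complex algebra is a record of type \<^typ>\<open>(complex, 'a) module\<close>. The locale
  \<^locale>\<open>algebra\<close> of \<^theory>\<open>HOL-Algebra.Module\<close> is restricted to commutative algebras,
  so it cannot be used here.
\<close>

locale complex_algebra = ring A for A :: "(complex, 'a) module" (structure) +
  assumes smult_closed: "x \<in> carrier A \<Longrightarrow> c \<odot> x \<in> carrier A"
    and smult_l_distr: "x \<in> carrier A \<Longrightarrow> (c + d) \<odot> x = c \<odot> x \<oplus> d \<odot> x"
    and smult_r_distr: "x \<in> carrier A \<Longrightarrow> y \<in> carrier A \<Longrightarrow> c \<odot> (x \<oplus> y) = c \<odot> x \<oplus> c \<odot> y"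
    and smult_assoc: "x \<in> carrier A \<Longrightarrow> (c * d) \<odot> x = c \<odot> (d \<odot> x)"
    and smult_one: "x \<in> carrier A \<Longrightarrow> 1 \<odot> x = x"
    and smult_mult_l: "x \<in> carrier A \<Longrightarrow> y \<in> carrier A \<Longrightarrow> (c \<odot> x) \<otimes> y = c \<odot> (x \<otimes> y)"
    and smult_mult_r: "x \<in> carrier A \<Longrightarrow> y \<in> carrier A \<Longrightarrow> x \<otimes> (c \<odot> y) = c \<odot> (x \<otimes> y)"

definition algebra_hom ::
    "(complex, 'a) module \<Rightarrow> (complex, 'b) module \<Rightarrow> ('a \<Rightarrow> 'b) set" where
  "algebra_hom A B =
     {h \<in> Ring.ring_hom A B. \<forall>c. \<forall>x\<in>carrier A. h (c \<odot>\<^bsub>A\<^esub> x) = c \<odot>\<^bsub>B\<^esub> h x}"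

text \<open>The monoid algebra: formal complex linear combinations of elements of \<open>M\<close>.\<close>

definition monoid_algebra :: "('m, 'z) monoid_scheme \<Rightarrow> (complex, 'm \<Rightarrow>\<^sub>0 complex) module" where
  "monoid_algebra M = \<lparr>
     carrier = {p. Poly_Mapping.keys p \<subseteq> carrier M},
     monoid.mult = (\<lambda>p r. \<Sum>x\<in>Poly_Mapping.keys p. \<Sum>y\<in>Poly_Mapping.keys r.
               Poly_Mapping.single (x \<otimes>\<^bsub>M\<^esub> y)
                 (Poly_Mapping.lookup p x * Poly_Mapping.lookup r y)),
     one = Poly_Mapping.single \<one>\<^bsub>M\<^esub> 1,
     zero = 0,
     add = (+),
     smult = (\<lambda>c. Poly_Mapping.map (\<lambda>x. c * x))\<rparr>"

text \<open>The linear extension to \<^const>\<open>monoid_algebra\<close> of a map \<open>f\<close> from the monoid to an algebra \<open>B\<close>.\<close>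

definition lin_ext ::
    "(complex, 'b) module \<Rightarrow> ('m \<Rightarrow> 'b) \<Rightarrow> ('m \<Rightarrow>\<^sub>0 complex) \<Rightarrow> 'b" where
  "lin_ext B f p =
     (\<Oplus>\<^bsub>B\<^esub> m \<in> Poly_Mapping.keys p. Poly_Mapping.lookup p m \<odot>\<^bsub>B\<^esub> f m)"

definition quot_algebra ::
    "(complex, 'a) module \<Rightarrow> 'a set \<Rightarrow> (complex, 'a set) module" where
  "quot_algebra A I = \<lparr>
     carrier = carrier (A Quot I),
     monoid.mult = monoid.mult (A Quot I),
     one = one (A Quot I),
     zero = zero (A Quot I),
     add = add (A Quot I),
     smult = (\<lambda>c X. \<Union>x\<in>X. I +>\<^bsub>A\<^esub> (c \<odot>\<^bsub>A\<^esub> x))\<rparr>"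

text \<open>
  The map induced by \<open>h\<close> on cosets. It is meaningful when \<open>h\<close> is constant on every coset.
\<close>

definition coset_map :: "('a \<Rightarrow> 'b) \<Rightarrow> 'a set \<Rightarrow> 'b" where
  "coset_map h X = the_elem (h ` X)"

section \<open>The tensor product of two algebras\<close>

text \<open>
  \<open>A \<otimes> B\<close> is the free vector space on \<open>A \<times> B\<close>, with the product
  \<open>(x, y) (x', y') = (x x', y y')\<close>, modulo the bilinearity relations. The linear span of these
  relations is already a two-sided ideal, so the ideal generated by them is that span.
\<close>

definition bilinearity_relations ::
    "(complex, 'a) module \<Rightarrow> (complex, 'b) module \<Rightarrow> ('a \<times> 'b \<Rightarrow>\<^sub>0 complex) set" where
  "bilinearity_relations A B =
     {Poly_Mapping.single (x \<oplus>\<^bsub>A\<^esub> x', y) 1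
        - Poly_Mapping.single (x, y) 1 - Poly_Mapping.single (x', y) 1 | x x' y.
        x \<in> carrier A \<and> x' \<in> carrier A \<and> y \<in> carrier B} \<union>
     {Poly_Mapping.single (x, y \<oplus>\<^bsub>B\<^esub> y') 1
        - Poly_Mapping.single (x, y) 1 - Poly_Mapping.single (x, y') 1 | x y y'.
        x \<in> carrier A \<and> y \<in> carrier B \<and> y' \<in> carrier B} \<union>
     {Poly_Mapping.single (c \<odot>\<^bsub>A\<^esub> x, y) 1 - Poly_Mapping.single (x, y) c | c x y.
        x \<in> carrier A \<and> y \<in> carrier B} \<union>
     {Poly_Mapping.single (x, c \<odot>\<^bsub>B\<^esub> y) 1 - Poly_Mapping.single (x, y) c | c x y.
        x \<in> carrier A \<and> y \<in> carrier B}"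

definition tensor_ideal ::
    "(complex, 'a) module \<Rightarrow> (complex, 'b) module \<Rightarrow> ('a \<times> 'b \<Rightarrow>\<^sub>0 complex) set" where
  "tensor_ideal A B = Idl\<^bsub>monoid_algebra (A \<times>\<times> B)\<^esub> (bilinearity_relations A B)"

definition tensor_algebra ::
    "(complex, 'a) module \<Rightarrow> (complex, 'b) module \<Rightarrow>
     (complex, ('a \<times> 'b \<Rightarrow>\<^sub>0 complex) set) module" where
  "tensor_algebra A B = quot_algebra (monoid_algebra (A \<times>\<times> B)) (tensor_ideal A B)"

definition tensor_elem ::
    "(complex, 'a) module \<Rightarrow> (complex, 'b) module \<Rightarrow> 'a \<Rightarrow> 'b \<Rightarrow> ('a \<times> 'b \<Rightarrow>\<^sub>0 complex) set" where
  "tensor_elem A B x y =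
     tensor_ideal A B +>\<^bsub>monoid_algebra (A \<times>\<times> B)\<^esub> Poly_Mapping.single (x, y) 1"

text \<open>The linear map \<open>A \<otimes> B \<rightarrow> C\<close> induced by a bilinear map \<open>f\<close>.\<close>

definition tensor_lift ::
    "(complex, 'c) module \<Rightarrow> ('a \<Rightarrow> 'b \<Rightarrow> 'c) \<Rightarrow> ('a \<times> 'b \<Rightarrow>\<^sub>0 complex) set \<Rightarrow> 'c" where
  "tensor_lift C f = coset_map (lin_ext C (\<lambda>(x, y). f x y))"

definition tensor_flip ::
    "(complex, 'a) module \<Rightarrow> (complex, 'b) module \<Rightarrow>
     ('a \<times> 'b \<Rightarrow>\<^sub>0 complex) set \<Rightarrow> ('b \<times> 'a \<Rightarrow>\<^sub>0 complex) set" where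
  "tensor_flip A B = tensor_lift (tensor_algebra B A) (\<lambda>x y. tensor_elem B A y x)"

section \<open>The quantum group\<close>

definition qint :: "complex \<Rightarrow> int \<Rightarrow> complex" where
  "qint q l = (q powi l - q powi (- l)) / (q - inverse q)"

primrec qfact :: "complex \<Rightarrow> nat \<Rightarrow> complex" where
  "qfact q 0 = 1"
| "qfact q (Suc n) = qint q (int (Suc n)) * qfact q n"

datatype uq_gen = GenK | GenKinv | GenE | GenF

definition free_monoid :: "'g list monoid" where
  "free_monoid = \<lparr>carrier = UNIV, monoid.mult = (@), one = []\<rparr>"

definition word :: "'g list \<Rightarrow> 'g list \<Rightarrow>\<^sub>0 complex" where
  "word w = Poly_Mapping.single w 1"

definition word_eval :: "(complex, 'b) module \<Rightarrow> ('g \<Rightarrow> 'b) \<Rightarrow> 'g list \<Rightarrow> 'b" where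
  "word_eval B \<phi> w = foldr (\<lambda>g y. \<phi> g \<otimes>\<^bsub>B\<^esub> y) w \<one>\<^bsub>B\<^esub>"

definition uq_relations :: "complex \<Rightarrow> (uq_gen list \<Rightarrow>\<^sub>0 complex) set" where
  "uq_relations q =
     {word [GenK, GenKinv] - word [],
      word [GenKinv, GenK] - word [],
      word [GenK, GenE] - Poly_Mapping.single [GenE, GenK] (q powi 2),
      word [GenK, GenF] - Poly_Mapping.single [GenF, GenK] (q powi (- 2)),
      word [GenE, GenF] - word [GenF, GenE]
        - Poly_Mapping.single [GenK] (1 / (q - inverse q))
        + Poly_Mapping.single [GenKinv] (1 / (q - inverse q))}"

type_synonym uq = "(uq_gen list \<Rightarrow>\<^sub>0 complex) set"

definition uq_ideal :: "complex \<Rightarrow> uq" where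
  "uq_ideal q = Idl\<^bsub>monoid_algebra free_monoid\<^esub> (uq_relations q)"

definition Uq :: "complex \<Rightarrow> (complex, uq) module" where
  "Uq q = quot_algebra (monoid_algebra free_monoid) (uq_ideal q)"

definition uq_of_gen :: "complex \<Rightarrow> uq_gen \<Rightarrow> uq" where
  "uq_of_gen q g = uq_ideal q +>\<^bsub>monoid_algebra free_monoid\<^esub> word [g]"

text \<open>The algebra homomorphism from \<^term>\<open>Uq q\<close> to \<open>B\<close> with prescribed values \<open>\<phi>\<close> on the
  generators, provided that these values satisfy the defining relations.\<close>

definition uq_lift :: "(complex, 'b) module \<Rightarrow> (uq_gen \<Rightarrow> 'b) \<Rightarrow> uq \<Rightarrow> 'b" where
  "uq_lift B \<phi> = coset_map (lin_ext B (word_eval B \<phi>))"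

abbreviation uq_tensor :: "complex \<Rightarrow> (complex, (uq \<times> uq \<Rightarrow>\<^sub>0 complex) set) module" where
  "uq_tensor q \<equiv> tensor_algebra (Uq q) (Uq q)"

definition uq_coproduct_gen :: "complex \<Rightarrow> uq_gen \<Rightarrow> (uq \<times> uq \<Rightarrow>\<^sub>0 complex) set" where
  "uq_coproduct_gen q g =
     (let K = uq_of_gen q GenK; Kinv = uq_of_gen q GenKinv;
          E = uq_of_gen q GenE; F = uq_of_gen q GenF;
          I = \<one>\<^bsub>Uq q\<^esub>; tens = tensor_elem (Uq q) (Uq q)
      in case g of
           GenK \<Rightarrow> tens K K
         | GenKinv \<Rightarrow> tens Kinv Kinv
         | GenE \<Rightarrow> tens E K \<oplus>\<^bsub>uq_tensor q\<^esub> tens I E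
         | GenF \<Rightarrow> tens F I \<oplus>\<^bsub>uq_tensor q\<^esub> tens Kinv F)"

definition uq_coproduct :: "complex \<Rightarrow> uq \<Rightarrow> (uq \<times> uq \<Rightarrow>\<^sub>0 complex) set" where
  "uq_coproduct q = uq_lift (uq_tensor q) (uq_coproduct_gen q)"

definition uq_coproduct_flipped :: "complex \<Rightarrow> uq \<Rightarrow> (uq \<times> uq \<Rightarrow>\<^sub>0 complex) set" where
  "uq_coproduct_flipped q Z = tensor_flip (Uq q) (Uq q) (uq_coproduct q Z)"

section \<open>Semicyclic representations\<close>

abbreviation mat_algebra :: "nat \<Rightarrow> (complex, complex mat) module" where
  "mat_algebra n \<equiv> module_mat TYPE(complex) n n"

definition qroot :: "nat \<Rightarrow> complex" where
  "qroot N = exp (complex_of_real pi * \<i> / of_nat N)"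

text \<open>The weight \<open>h\<^sub>k\<close>, so that \<open>K v\<^sub>k = q\<^sup>h v\<^sub>k\<close> for \<open>h = h\<^sub>k\<close>.\<close>

definition weight :: "nat \<Rightarrow> nat \<Rightarrow> nat \<Rightarrow> int" where
  "weight N i k = 1 - int N + 2 * (int k - int i)"

text \<open>
  The entry \<open>(r, c)\<close> of a matrix is the coefficient of \<open>v\<^sub>r\<close> in the image of \<open>v\<^sub>c\<close>.
  For \<open>F\<close>, the basis vector \<open>v\<^sub>c\<close> is the one whose index is congruent to \<open>i + k\<close>, where
  \<open>k = (c - i) mod N\<close>.
\<close>

definition semicyclic_gen :: "nat \<Rightarrow> complex \<Rightarrow> nat \<Rightarrow> uq_gen \<Rightarrow> complex mat" where
  "semicyclic_gen N a i g = mat N N (\<lambda>(r, c).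
     case g of
       GenK \<Rightarrow> (if r = c then qroot N powi weight N i c else 0)
     | GenKinv \<Rightarrow> (if r = c then qroot N powi (- weight N i c) else 0)
     | GenE \<Rightarrow>
         (if c < N - 1 then (if r = c + 1 then 1 else 0)
          else (if r = 0 then a else 0))
     | GenF \<Rightarrow>
         (let k = (int c - int i) mod int N;
              s = qint (qroot N) k * qint (qroot N) (int N - k)
          in if int r = (int c - 1) mod int N
             then (if c = 0 then s / a else s)
             else 0))"

definition semicyclic :: "nat \<Rightarrow> complex \<Rightarrow> nat \<Rightarrow> uq \<Rightarrow> complex mat" where
  "semicyclic N a i = uq_lift (mat_algebra N) (semicyclic_gen N a i)"

text \<open>
  The Kronecker product: the matrix of \<open>A \<otimes> B\<close> in the basis of \<open>V \<otimes> W\<close> in which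
  \<open>v\<^sub>j \<otimes> w\<^sub>k\<close> has the index \<open>j * dim W + k\<close>.
\<close>

definition kron :: "complex mat \<Rightarrow> complex mat \<Rightarrow> complex mat" where
  "kron A B = mat (dim_row A * dim_row B) (dim_col A * dim_col B)
     (\<lambda>(r, c). A $$ (r div dim_row B, c div dim_col B) * B $$ (r mod dim_row B, c mod dim_col B))"

definition semicyclic_tensor ::
    "nat \<Rightarrow> complex \<Rightarrow> nat \<Rightarrow> (uq \<times> uq \<Rightarrow>\<^sub>0 complex) set \<Rightarrow> complex mat" where
  "semicyclic_tensor N a i =
     tensor_lift (mat_algebra (N * N)) (\<lambda>x y. kron (semicyclic N a i x) (semicyclic N a i y))"

section \<open>The R-matrix\<close>

text \<open>
  The action of \<open>q\<close> to the power \<open>H \<otimes> H / 2\<close>, with \<open>q\<^sup>x = exp (\<pi> \<i> x / N)\<close> for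
  \<open>q = exp (\<pi> \<i> / N)\<close>. For odd \<open>N\<close> all weights are even, so the exponents are integers and
  there is no choice of branch.
\<close>

definition R_diag :: "nat \<Rightarrow> nat \<Rightarrow> complex mat" where
  "R_diag N i = mat (N * N) (N * N) (\<lambda>(r, c).
     if r = c
     then exp (complex_of_real pi * \<i> / of_nat N
               * (of_int (weight N i (c div N) * weight N i (c mod N)) / 2))
     else 0)"

definition R_image :: "nat \<Rightarrow> complex \<Rightarrow> nat \<Rightarrow> complex mat" where
  "R_image N a i =
     (let q = qroot N;
          E = semicyclic N a i (uq_of_gen q GenE);
          F = semicyclic N a i (uq_of_gen q GenF)
      in R_diag N i *
         (\<Oplus>\<^bsub>mat_algebra (N * N)\<^esub> l \<in> {0..<N}.
            ((q - inverse q) ^ l / qfact q l * q ^ (l * (l - 1) div 2))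
              \<cdot>\<^sub>m kron (E ^\<^sub>m l) (F ^\<^sub>m l)))"

section \<open>The defined algebras and induced maps\<close>

text \<open>
  The quotients are complex algebras, and \<^const>\<open>tensor_lift\<close> and \<^const>\<open>uq_lift\<close> have the
  universal properties for which they are named.
\<close>


lemma pm_induct [consumes 1, case_names zero step]:
  assumes "Poly_Mapping.keys p \<subseteq> C"
    and "P 0"
    and "\<And>x c p. x \<in> C \<Longrightarrow> Poly_Mapping.keys p \<subseteq> C \<Longrightarrow> P p \<Longrightarrow> P (Poly_Mapping.single x c + p)"
  shows "P (p :: 'a \<Rightarrow>\<^sub>0 complex)"
proof -
  have "P (\<Sum>x\<in>S. Poly_Mapping.single x (c x)) \<and> Poly_Mapping.keys (\<Sum>x\<in>S. Poly_Mapping.single x (c x)) \<subseteq> C"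
    if "finite S" "S \<subseteq> C" for S and c :: "'a \<Rightarrow> complex"
    using that
  proof (induction S)
    case empty then show ?case using assms(2) by simp
  next
    case (insert x S)
    have "Poly_Mapping.keys (Poly_Mapping.single x (c x) + (\<Sum>x\<in>S. Poly_Mapping.single x (c x))) \<subseteq> C"
      using Poly_Mapping.keys_add[of "Poly_Mapping.single x (c x)"] insert by (fastforce split: if_splits)
    then show ?case using insert assms(3) by simp
  qed
  from this[of "Poly_Mapping.keys p" "Poly_Mapping.lookup p"] assms(1)
  have "P (\<Sum>x\<in>Poly_Mapping.keys p. Poly_Mapping.single x (Poly_Mapping.lookup p x))" by simp
  moreover have "(\<Sum>x\<in>Poly_Mapping.keys p. Poly_Mapping.single x (Poly_Mapping.lookup p x)) = p"
    by (rule poly_mapping_eqI)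
      (auto simp: lookup_sum lookup_single when_def in_keys_iff)
  ultimately show ?thesis by simp
qed

lemma pm_induct0 [case_names zero step]:
  assumes "P 0" and "\<And>x c p. P p \<Longrightarrow> P (Poly_Mapping.single x c + p)"
  shows "P (p :: 'a \<Rightarrow>\<^sub>0 complex)"
  by (rule pm_induct[of p UNIV]) (use assms in auto)

definition ma_mult where "ma_mult M p r = (\<Sum>x\<in>Poly_Mapping.keys p. \<Sum>y\<in>Poly_Mapping.keys r.
               Poly_Mapping.single (x \<otimes>\<^bsub>M\<^esub> y)
                 (Poly_Mapping.lookup p x * Poly_Mapping.lookup r y :: complex))"

lemma ma_simps [simp]:
  "carrier (monoid_algebra M) = {p. Poly_Mapping.keys p \<subseteq> carrier M}"
  "monoid.mult (monoid_algebra M) p r = ma_mult M p r"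
  "one (monoid_algebra M) = Poly_Mapping.single \<one>\<^bsub>M\<^esub> 1"
  "zero (monoid_algebra M) = 0"
  "add (monoid_algebra M) p r = p + r"
  "smult (monoid_algebra M) c p = Poly_Mapping.map (\<lambda>x. c * x) p"
  by (auto simp: monoid_algebra_def ma_mult_def)

lemma ma_mult_ext:
  assumes "finite S" "finite T" "Poly_Mapping.keys p \<subseteq> S" "Poly_Mapping.keys r \<subseteq> T"
  shows "ma_mult M p r = (\<Sum>x\<in>S. \<Sum>y\<in>T. Poly_Mapping.single (x \<otimes>\<^bsub>M\<^esub> y)
                 (Poly_Mapping.lookup p x * Poly_Mapping.lookup r y))"
proof -
  have "ma_mult M p r = (\<Sum>x\<in>Poly_Mapping.keys p. \<Sum>y\<in>T. Poly_Mapping.single (x \<otimes>\<^bsub>M\<^esub> y)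
                 (Poly_Mapping.lookup p x * Poly_Mapping.lookup r y))"
    unfolding ma_mult_def
    by (intro sum.cong refl sum.mono_neutral_left) (use assms in \<open>auto simp: in_keys_iff\<close>)
  also have "\<dots> = (\<Sum>x\<in>S. \<Sum>y\<in>T. Poly_Mapping.single (x \<otimes>\<^bsub>M\<^esub> y)
                 (Poly_Mapping.lookup p x * Poly_Mapping.lookup r y))"
    by (intro sum.mono_neutral_left) (use assms in \<open>auto simp: in_keys_iff\<close>)
  finally show ?thesis .
qed

lemma ma_add_l: "ma_mult M (p + p') r = ma_mult M p r + ma_mult M p' r"
proof -
  let ?S = "Poly_Mapping.keys p \<union> Poly_Mapping.keys p'"
  have s: "Poly_Mapping.keys (p + p') \<subseteq> ?S" by (rule Poly_Mapping.keys_add)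
  show ?thesis
    by (subst (1 2 3) ma_mult_ext[of ?S "Poly_Mapping.keys r"])
      (use s in \<open>auto simp: lookup_add algebra_simps single_add sum.distrib\<close>)
qed

lemma ma_add_r: "ma_mult M p (r + r') = ma_mult M p r + ma_mult M p r'"
proof -
  let ?S = "Poly_Mapping.keys r \<union> Poly_Mapping.keys r'"
  have s: "Poly_Mapping.keys (r + r') \<subseteq> ?S" by (rule Poly_Mapping.keys_add)
  show ?thesis
    by (subst (1 2 3) ma_mult_ext[of "Poly_Mapping.keys p" ?S])
      (use s in \<open>auto simp: lookup_add algebra_simps single_add sum.distrib\<close>)
qed

lemma ma_single [simp]: "ma_mult M (Poly_Mapping.single x c) (Poly_Mapping.single y d) =
   Poly_Mapping.single (x \<otimes>\<^bsub>M\<^esub> y) (c * d)"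
  by (subst ma_mult_ext[of "{x}" "{y}"]) auto

lemma ma_0 [simp]: "ma_mult M 0 r = 0" "ma_mult M p 0 = 0" by (auto simp: ma_mult_def)

lemma sm_add: "Poly_Mapping.map (\<lambda>x. c * x) (p + r) = Poly_Mapping.map (\<lambda>x. c * x) p + Poly_Mapping.map (\<lambda>x. c * x) (r:: 'a \<Rightarrow>\<^sub>0 complex)"
  by (rule poly_mapping_eqI) (auto simp: lookup_add map.rep_eq when_def distrib_left, metis distrib_left mult_zero_right)
lemma sm_single [simp]: "Poly_Mapping.map (\<lambda>x. c * x) (Poly_Mapping.single y d) = Poly_Mapping.single y (c * d :: complex)"
  by (rule poly_mapping_eqI) (auto simp: map.rep_eq lookup_single when_def)
lemma sm_0 [simp]: "Poly_Mapping.map (\<lambda>x. c * x) 0 = (0 :: 'a \<Rightarrow>\<^sub>0 complex)"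
  by (rule poly_mapping_eqI) (auto simp: map.rep_eq lookup_single when_def)
lemma keys_sm: "Poly_Mapping.keys (Poly_Mapping.map (\<lambda>x. c * x) (p :: 'a \<Rightarrow>\<^sub>0 complex)) \<subseteq> Poly_Mapping.keys p"
  by (auto simp: in_keys_iff map.rep_eq when_def)

lemma keys_add_sub: "Poly_Mapping.keys p \<subseteq> C \<Longrightarrow> Poly_Mapping.keys r \<subseteq> C \<Longrightarrow> Poly_Mapping.keys (p + (r::'a \<Rightarrow>\<^sub>0 complex)) \<subseteq> C"
  using Poly_Mapping.keys_add[of p r] by blast

lemma keys_sum_sub: "(\<And>x. x \<in> S \<Longrightarrow> Poly_Mapping.keys (f x :: 'a \<Rightarrow>\<^sub>0 complex) \<subseteq> C) \<Longrightarrow> Poly_Mapping.keys (sum f S) \<subseteq> C"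
  by (induction S rule: infinite_finite_induct) (simp_all add: keys_add_sub del: Poly_Mapping.keys_add)

context monoid begin

lemma ma_closed: "Poly_Mapping.keys p \<subseteq> carrier G \<Longrightarrow> Poly_Mapping.keys r \<subseteq> carrier G \<Longrightarrow>
  Poly_Mapping.keys (ma_mult G p r) \<subseteq> carrier G"
  unfolding ma_mult_def by (intro keys_sum_sub) (auto split: if_splits)

lemma ma_assoc:
  assumes "Poly_Mapping.keys p \<subseteq> carrier G" "Poly_Mapping.keys r \<subseteq> carrier G" "Poly_Mapping.keys s \<subseteq> carrier G"
  shows "ma_mult G (ma_mult G p r) s = ma_mult G p (ma_mult G r s)"
  using assms(1)
proof (induction p rule: pm_induct)
  case (step x c p)
  have "ma_mult G (ma_mult G (Poly_Mapping.single x c) r) s = ma_mult G (Poly_Mapping.single x c) (ma_mult G r s)"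
    using assms(2)
  proof (induction r rule: pm_induct)
    case (step y d r)
    have "ma_mult G (ma_mult G (Poly_Mapping.single x c) (Poly_Mapping.single y d)) s 
      = ma_mult G (Poly_Mapping.single x c) (ma_mult G (Poly_Mapping.single y d) s)"
      using assms(3)
      by (induction s rule: pm_induct) (use step \<open>x \<in> carrier G\<close> in \<open>auto simp: ma_add_l ma_add_r m_assoc mult.assoc\<close>)
    then show ?case using step by (simp add: ma_add_l ma_add_r)
  qed auto
  then show ?case using step by (simp add: ma_add_l ma_add_r)
qed auto

lemma ma_one_l: assumes "Poly_Mapping.keys p \<subseteq> carrier G" shows "ma_mult G (Poly_Mapping.single \<one> 1) p = p"
  using assms by (induction p rule: pm_induct) (auto simp: ma_add_r)
lemma ma_one_r: assumes "Poly_Mapping.keys p \<subseteq> carrier G" shows "ma_mult G p (Poly_Mapping.single \<one> 1) = p"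
  using assms by (induction p rule: pm_induct) (auto simp: ma_add_l)

lemma sm_l: "ma_mult G (Poly_Mapping.map (\<lambda>x. c * x) p) r = Poly_Mapping.map (\<lambda>x. c * x) (ma_mult G p r)"
proof (induction p rule: pm_induct0)
  case (step x d p)
  have "ma_mult G (Poly_Mapping.single x (c*d)) r = Poly_Mapping.map ((*) c) (ma_mult G (Poly_Mapping.single x d) r)"
    by (induction r rule: pm_induct0) (auto simp: ma_add_r sm_add mult.assoc)
  then show ?case using step by (simp add: ma_add_l sm_add)
qed auto
lemma sm_r: "ma_mult G p (Poly_Mapping.map (\<lambda>x. c * x) r) = Poly_Mapping.map (\<lambda>x. c * x) (ma_mult G p r)"
proof (induction p rule: pm_induct0)
  case (step x d p)
  have "ma_mult G (Poly_Mapping.single x d) (Poly_Mapping.map (\<lambda>x. c * x) r) = Poly_Mapping.map ((*) c) (ma_mult G (Poly_Mapping.single x d) r)"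
    by (induction r rule: pm_induct0) (auto simp: ma_add_r sm_add mult.left_commute)
  then show ?case using step by (simp add: ma_add_l sm_add)
qed auto

lemma ring_ma: "ring (monoid_algebra G)"
proof (rule ringI)
  show "abelian_group (monoid_algebra G)"
  proof (rule abelian_groupI)
    fix x assume "x \<in> carrier (monoid_algebra G)"
    then show "\<exists>y\<in>carrier (monoid_algebra G). y \<oplus>\<^bsub>monoid_algebra G\<^esub> x = \<zero>\<^bsub>monoid_algebra G\<^esub>"
      by (intro bexI[of _ "-x"]) auto
  qed (simp_all add: algebra_simps keys_add_sub del: Poly_Mapping.keys_add)
  show "Group.monoid (monoid_algebra G)"
    by (rule monoidI) (simp_all add: ma_assoc ma_one_l ma_one_r ma_closed)
qed (auto simp: ma_add_l ma_add_r)

lemma complex_algebra_ma: "complex_algebra (monoid_algebra G)"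
proof -
  interpret r: ring "monoid_algebra G" by (rule ring_ma)
  show ?thesis
  proof (unfold_locales, goal_cases)
    case (1 x c) then show ?case using keys_sm by fastforce
  next case (2 x c d) then show ?case 
      by (auto intro!: poly_mapping_eqI simp: lookup_add map.rep_eq when_def algebra_simps)
  next case (3 x c d) then show ?case  by (auto simp: sm_add)
  next case (4 x c d) then show ?case 
      by (auto intro!: poly_mapping_eqI simp: map.rep_eq when_def algebra_simps)
  next case (5 x) then show ?case 
      by (auto intro!: poly_mapping_eqI simp: map.rep_eq when_def algebra_simps)
  next case (6 x y c) then show ?case by (simp add: sm_l)
  next case (7 x y c) then show ?case by (simp add: sm_r)
  qed
qed
end

context complex_algebra begin

lemma zero_sm: "x \<in> carrier A \<Longrightarrow> 0 \<odot> x = \<zero>"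
  using smult_l_distr[of x 0 0] smult_closed[of x 0] by simp

lemma le_ext:
  assumes "finite S" "Poly_Mapping.keys p \<subseteq> S" "f \<in> S \<rightarrow> carrier A"
  shows "lin_ext A f p = (\<Oplus>m\<in>S. Poly_Mapping.lookup p m \<odot> f m)"
  unfolding lin_ext_def
  by (rule add.finprod_mono_neutral_cong_left) (use assms in \<open>auto intro!: smult_closed zero_sm simp: in_keys_iff Pi_iff\<close>)

lemma le_closed: "f \<in> C \<rightarrow> carrier A \<Longrightarrow> Poly_Mapping.keys p \<subseteq> C \<Longrightarrow> lin_ext A f p \<in> carrier A"
  unfolding lin_ext_def by (intro finsum_closed) (auto intro!: smult_closed)

lemma le_add: assumes "f \<in> C \<rightarrow> carrier A" "Poly_Mapping.keys p \<subseteq> C" "Poly_Mapping.keys r \<subseteq> C"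
  shows "lin_ext A f (p + r) = lin_ext A f p \<oplus> lin_ext A f r"
proof -
  let ?S = "Poly_Mapping.keys p \<union> Poly_Mapping.keys r"
  have s: "Poly_Mapping.keys (p + r) \<subseteq> ?S" by (rule Poly_Mapping.keys_add)
  have f: "f \<in> ?S \<rightarrow> carrier A" using assms by auto
  have "lin_ext A f (p + r) = (\<Oplus>m\<in>?S. Poly_Mapping.lookup p m \<odot> f m \<oplus> Poly_Mapping.lookup r m \<odot> f m)"
    apply (subst le_ext[OF _ s f], simp)
    apply (rule finsum_cong'[OF refl])
    using f by (auto simp: lookup_add smult_l_distr Pi_iff smult_closed)
  also have "\<dots> = lin_ext A f p \<oplus> lin_ext A f r"
    using f by (subst finsum_addf) (auto simp: le_ext[of ?S] smult_closed Pi_iff)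
  finally show ?thesis .
qed

lemma le_single: "f x \<in> carrier A \<Longrightarrow> lin_ext A f (Poly_Mapping.single x c) = c \<odot> f x"
  by (subst le_ext[of "{x}"]) (auto simp: smult_closed)

lemma le_0: "lin_ext A f 0 = \<zero>" by (simp add: lin_ext_def)

lemma smult_zero: "c \<odot> \<zero> = \<zero>"
  using smult_r_distr[of \<zero> \<zero> c] smult_closed[of \<zero> c] by simp

lemma le_smult: assumes f: "f \<in> C \<rightarrow> carrier A" and p: "Poly_Mapping.keys p \<subseteq> C"
  shows "lin_ext A f (Poly_Mapping.map (\<lambda>x. c * x) p) = c \<odot> lin_ext A f p"
  using p
proof (induction p rule: pm_induct)
  case (step x d p)
  have fx: "f x \<in> carrier A" using step f by auto
  have k: "Poly_Mapping.keys (Poly_Mapping.single x e) \<subseteq> C" for e :: complex using step by auto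
  have "Poly_Mapping.keys (Poly_Mapping.map (\<lambda>x. c * x) p) \<subseteq> C" using keys_sm[of c p] step by blast
  then show ?case using step k fx f
    by (simp add: sm_add le_add[of f C] le_single smult_r_distr smult_closed le_closed[of f C] smult_assoc del: keys_single)
qed (auto simp: le_0 smult_zero)

lemma le_mult:
  assumes "Group.monoid M" and f: "f \<in> carrier M \<rightarrow> carrier A"
    and fm: "\<And>x y. x \<in> carrier M \<Longrightarrow> y \<in> carrier M \<Longrightarrow> f (x \<otimes>\<^bsub>M\<^esub> y) = f x \<otimes> f y"
    and p: "Poly_Mapping.keys p \<subseteq> carrier M" and r: "Poly_Mapping.keys r \<subseteq> carrier M"
  shows "lin_ext A f (ma_mult M p r) = lin_ext A f p \<otimes> lin_ext A f r"
proof -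
  interpret M: monoid M by fact
  note add = le_add[OF f]
  note cl = le_closed[OF f]
  have k: "Poly_Mapping.keys (Poly_Mapping.single x e) \<subseteq> carrier M" if "x \<in> carrier M" for x and e :: complex
    using that by auto
  have s: "lin_ext A f (ma_mult M (Poly_Mapping.single x c) r) = lin_ext A f (Poly_Mapping.single x c) \<otimes> lin_ext A f r" 
    if x: "x \<in> carrier M" for x c
    using r
  proof (induction r rule: pm_induct)
    case zero then show ?case using f x by (simp add: le_0 le_single smult_closed Pi_iff)
  next
    case (step y d r)
    have fx: "f x \<in> carrier A" "f y \<in> carrier A" using x step.hyps f by auto
    have "lin_ext A f (ma_mult M (Poly_Mapping.single x c) (Poly_Mapping.single y d)) = lin_ext A f (Poly_Mapping.single x c) \<otimes> lin_ext A f (Poly_Mapping.single y d)"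
      using fx x step.hyps smult_assoc[of "f x \<otimes> f y" c d] smult_assoc[of "f x \<otimes> f y" d c] by (simp add: le_single fm smult_mult_l smult_mult_r smult_closed mult.commute)
    then show ?case using step k x  unfolding ma_add_r
      by (subst add) (auto simp: add cl M.ma_closed r_distr simp del: keys_single ma_single)
  qed
  show ?thesis using p
  proof (induction p rule: pm_induct)
    case zero then show ?case using cl[OF r] by (simp add: le_0)
  next
    case (step x c p)
    then show ?case using s[of x c] k[of x] r unfolding ma_add_l
      by (subst add) (auto simp: add cl M.ma_closed l_distr simp del: keys_single ma_single)
  qed
qed

lemma le_hom:
  assumes "Group.monoid M" and f: "f \<in> carrier M \<rightarrow> carrier A"
    and fm: "\<And>x y. x \<in> carrier M \<Longrightarrow> y \<in> carrier M \<Longrightarrow> f (x \<otimes>\<^bsub>M\<^esub> y) = f x \<otimes> f y"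
    and f1: "f \<one>\<^bsub>M\<^esub> = \<one>"
  shows "lin_ext A f \<in> algebra_hom (monoid_algebra M) A"
proof -
  interpret M: monoid M by fact
  show ?thesis unfolding algebra_hom_def Ring.ring_hom_def
    using le_mult[OF assms(1-3)] le_closed[OF f] le_add[OF f] le_smult[OF f] f1
    by (auto simp: le_single smult_one)
qed

lemma quot_sm:
  assumes "ideal I A" "x \<in> carrier A"
  shows "c \<odot>\<^bsub>quot_algebra A I\<^esub> (I +> x) = I +> (c \<odot> x)"
proof -
  interpret I: ideal I A by fact
  interpret Ab: abelian_subgroup I A
      by (rule abelian_subgroupI3) (rule I.additive_subgroup_axioms, rule abelian_group_axioms)
  have eq: "I +> (c \<odot> y) = I +> (c \<odot> x)" if "y \<in> I +> x" for y
  proof -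
    from that obtain i where i: "i \<in> I" "y = i \<oplus> x" by (auto simp: a_r_coset_def')
    have ic: "i \<in> carrier A" using i I.a_Hcarr by blast
    have "(c \<odot> \<one>) \<otimes> i \<in> I" using i by (intro I.I_l_closed) (auto simp: smult_closed)
    then have "c \<odot> i \<in> I" using ic by (simp add: smult_mult_l)
    moreover have "c \<odot> y = c \<odot> i \<oplus> c \<odot> x" using i ic assms by (simp add: smult_r_distr)
    ultimately have "c \<odot> y \<in> I +> (c \<odot> x)" by (auto simp: a_r_coset_def')
    from a_repr_independence[OF this smult_closed[OF assms(2)] I.a_subgroup] show ?thesis by (rule sym)
  qed
  have "x \<in> I +> x" using I.a_rcos_self assms by simp
  then have "(\<Union>y\<in>I +> x. I +> (c \<odot> y)) = I +> (c \<odot> x)" using eq by blast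
  then show ?thesis by (simp add: quot_algebra_def)
qed

lemma quot_simps:
  assumes "ideal I A"
  shows "carrier (quot_algebra A I) = (\<lambda>x. I +> x) ` carrier A"
   "\<And>x y. x \<in> carrier A \<Longrightarrow> y \<in> carrier A \<Longrightarrow> (I +> x) \<otimes>\<^bsub>quot_algebra A I\<^esub> (I +> y) = I +> (x \<otimes> y)"
   "\<And>x y. x \<in> carrier A \<Longrightarrow> y \<in> carrier A \<Longrightarrow> (I +> x) \<oplus>\<^bsub>quot_algebra A I\<^esub> (I +> y) = I +> (x \<oplus> y)"
   "\<one>\<^bsub>quot_algebra A I\<^esub> = I +> \<one>"
   "\<zero>\<^bsub>quot_algebra A I\<^esub> = I +> \<zero>"
proof -
  interpret I: ideal I A by fact
  show "carrier (quot_algebra A I) = (\<lambda>x. I +> x) ` carrier A"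
    by (auto simp: quot_algebra_def FactRing_def A_RCOSETS_def')
next
  interpret I: ideal I A by fact
  interpret Q: abelian_subgroup I A by (rule abelian_subgroupI3) (rule I.additive_subgroup_axioms, rule abelian_group_axioms) 
  fix x y assume xy: "x \<in> carrier A" "y \<in> carrier A"
  show "(I +> x) \<otimes>\<^bsub>quot_algebra A I\<^esub> (I +> y) = I +> (x \<otimes> y)"
    using xy by (simp add: quot_algebra_def FactRing_def I.rcoset_mult_add)
  show "(I +> x) \<oplus>\<^bsub>quot_algebra A I\<^esub> (I +> y) = I +> (x \<oplus> y)"
    using xy by (simp add: quot_algebra_def FactRing_def I.a_rcos_sum)
next
  interpret I: ideal I A by fact
  show "\<one>\<^bsub>quot_algebra A I\<^esub> = I +> \<one>" "\<zero>\<^bsub>quot_algebra A I\<^esub> = I +> \<zero>"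
    by (simp_all add: quot_algebra_def FactRing_def a_coset_add_zero I.a_subset)
qed

lemma quot_alg:
  assumes "ideal I A"
  shows "complex_algebra (quot_algebra A I)"
proof -
  interpret I: ideal I A by fact
  interpret F: ring "A Quot I" by (rule I.quotient_is_ring)
  have r: "ring (quot_algebra A I)"
  proof -
    have s: "carrier (quot_algebra A I) = carrier (A Quot I)"
       "monoid.mult (quot_algebra A I) = monoid.mult (A Quot I)"
       "one (quot_algebra A I) = one (A Quot I)"
       "zero (quot_algebra A I) = zero (A Quot I)"
       "add (quot_algebra A I) = add (A Quot I)" by (simp_all add: quot_algebra_def)
    show ?thesis
    proof (rule ringI)
      show "abelian_group (quot_algebra A I)"
      proof (rule abelian_groupI)
        fix x assume "x \<in> carrier (quot_algebra A I)"
        then show "\<exists>y\<in>carrier (quot_algebra A I). y \<oplus>\<^bsub>quot_algebra A I\<^esub> x = \<zero>\<^bsub>quot_algebra A I\<^esub>"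
          by (intro bexI[of _ "\<ominus>\<^bsub>A Quot I\<^esub> x"]) (simp_all add: s F.l_neg)
      qed (simp_all add: s F.a_ac)
      show "Group.monoid (quot_algebra A I)"
        by (rule monoidI) (simp_all add: s F.m_assoc)
    qed (simp_all add: s F.l_distr F.r_distr)
  qed
  interpret Q: ring "quot_algebra A I" by (rule r)
  note q = quot_simps[OF assms] quot_sm[OF assms]
  show ?thesis
  proof (unfold_locales, goal_cases)
    case 1 then show ?case unfolding q(1) by (elim imageE) (simp add: q(2-) smult_closed)
  next case 2 then show ?case unfolding q(1) by (elim imageE) (simp add: q(3,6) smult_closed smult_l_distr)
  next case 3 then show ?case unfolding q(1) by (elim imageE) (simp add: q(3,6) smult_closed smult_r_distr)
  next case 4 then show ?case unfolding q(1) by (elim imageE) (simp add: q(3,6) smult_closed smult_assoc)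
  next case 5 then show ?case unfolding q(1) by (elim imageE) (simp add: q(3,6) smult_one)
  next case 6 then show ?case unfolding q(1) by (elim imageE) (simp add: q(2,6) smult_closed smult_mult_l)
  next case 7 then show ?case unfolding q(1) by (elim imageE) (simp add: q(2,6) smult_closed smult_mult_r)
  qed
qed

lemma coset_map_hom:
  assumes "S \<subseteq> carrier A" "complex_algebra B" "h \<in> algebra_hom A B" "\<And>x. x \<in> S \<Longrightarrow> h x = \<zero>\<^bsub>B\<^esub>"
  defines "I \<equiv> Idl S"
  shows "coset_map h \<in> algebra_hom (quot_algebra A I) B"
    "\<And>x. x \<in> carrier A \<Longrightarrow> coset_map h (I +> x) = h x"
proof -
  interpret B: complex_algebra B by fact
  have hr: "h \<in> Ring.ring_hom A B" and hs: "\<And>c x. x \<in> carrier A \<Longrightarrow> h (c \<odot> x) = c \<odot>\<^bsub>B\<^esub> h x"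
    using assms(3) by (auto simp: algebra_hom_def)
  interpret h: ring_hom_ring A B h
    using hr by unfold_locales (auto simp: Ring.ring_hom_def)
  have "ideal (a_kernel A B h) A" by (rule h.kernel_is_ideal)
  moreover have "S \<subseteq> a_kernel A B h" unfolding a_kernel_def' using assms(1,4) by blast
  ultimately have Ik: "I \<subseteq> a_kernel A B h" unfolding I_def by (rule genideal_minimal)
  have I: "ideal I A" unfolding I_def using assms(1) by (rule genideal_ideal)
  interpret I: ideal I A by fact
  have cm: "coset_map h (I +> x) = h x" if x: "x \<in> carrier A" for x
  proof -
    have "h y = h x" if "y \<in> I +> x" for y
    proof -
      from that obtain i where i: "i \<in> I" "y = i \<oplus> x" by (auto simp: a_r_coset_def')
      have "i \<in> carrier A" "h i = \<zero>\<^bsub>B\<^esub>" using Ik i(1) unfolding a_kernel_def' by blast+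
      then show ?thesis unfolding i(2) using x by simp
    qed
    moreover have "x \<in> I +> x" using I.a_rcos_self x by simp
    ultimately have "h ` (I +> x) = {h x}" by blast
    then show ?thesis by (simp add: coset_map_def)
  qed
  show "coset_map h (I +> x) = h x" if "x \<in> carrier A" for x using cm[OF that] .
  note q = quot_simps[OF I] quot_sm[OF I]
  show "coset_map h \<in> algebra_hom (quot_algebra A I) B"
    unfolding algebra_hom_def Ring.ring_hom_def
    by (intro CollectI conjI ballI allI impI Pi_I; (unfold q(1))?; (elim conjE)?; (elim imageE)?; hypsubst?; simp add: q(2-) cm hs smult_closed)
qed

end

lemma keys_diff_sub: "Poly_Mapping.keys p \<subseteq> C \<Longrightarrow> Poly_Mapping.keys r \<subseteq> C \<Longrightarrow> Poly_Mapping.keys (p - (r::'a \<Rightarrow>\<^sub>0 complex)) \<subseteq> C"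
  by (auto simp: in_keys_iff lookup_minus subset_iff) metis

lemma bilin_sub: 
  assumes "complex_algebra A" "complex_algebra B"
  shows "bilinearity_relations A B \<subseteq> carrier (monoid_algebra (A \<times>\<times> B))"
proof -
  interpret A: complex_algebra A by fact
  interpret B: complex_algebra B by fact
  note d = keys_diff_sub
  have "Poly_Mapping.keys p \<subseteq> carrier A \<times> carrier B" if "p \<in> bilinearity_relations A B" for p
    using that unfolding bilinearity_relations_def
    by (elim UnE CollectE exE conjE; hypsubst; intro d; simp add: A.smult_closed B.smult_closed)
  then show ?thesis by auto
qed

lemma monoid_prod: assumes "complex_algebra A" "complex_algebra B" shows "Group.monoid (A \<times>\<times> B)"
proof -
  interpret A: complex_algebra A by fact
  interpret B: complex_algebra B by fact
  show ?thesis by (rule DirProd_monoid) unfold_locales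
qed

lemma tensor_alg: assumes "complex_algebra A" "complex_algebra B" 
  shows "complex_algebra (tensor_algebra A B)"  "ideal (tensor_ideal A B) (monoid_algebra (A \<times>\<times> B))"
proof -
  interpret M: complex_algebra "monoid_algebra (A \<times>\<times> B)"
    by (rule monoid.complex_algebra_ma[OF monoid_prod[OF assms]])
  show "ideal (tensor_ideal A B) (monoid_algebra (A \<times>\<times> B))" unfolding tensor_ideal_def
    by (rule M.genideal_ideal[OF bilin_sub[OF assms]])
  then show "complex_algebra (tensor_algebra A B)" unfolding tensor_algebra_def
    by (rule M.quot_alg)
qed

lemma tensor_lift:
  assumes "complex_algebra A" "complex_algebra B" "complex_algebra C"
    and fc: "\<And>x y. x \<in> carrier A \<Longrightarrow> y \<in> carrier B \<Longrightarrow> f x y \<in> carrier C"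
    and fm: "\<And>x y x' y'. x \<in> carrier A \<Longrightarrow> y \<in> carrier B \<Longrightarrow> x' \<in> carrier A \<Longrightarrow> y' \<in> carrier B \<Longrightarrow>
        f (x \<otimes>\<^bsub>A\<^esub> x') (y \<otimes>\<^bsub>B\<^esub> y') = f x y \<otimes>\<^bsub>C\<^esub> f x' y'"
    and f1: "f \<one>\<^bsub>A\<^esub> \<one>\<^bsub>B\<^esub> = \<one>\<^bsub>C\<^esub>"
    and fa: "\<And>x y x'. x \<in> carrier A \<Longrightarrow> y \<in> carrier B \<Longrightarrow> x' \<in> carrier A \<Longrightarrow>
        f (x \<oplus>\<^bsub>A\<^esub> x') y = f x y \<oplus>\<^bsub>C\<^esub> f x' y"
    and fb: "\<And>x y y'. x \<in> carrier A \<Longrightarrow> y \<in> carrier B \<Longrightarrow> y' \<in> carrier B \<Longrightarrow>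
        f x (y \<oplus>\<^bsub>B\<^esub> y') = f x y \<oplus>\<^bsub>C\<^esub> f x y'"
    and fs: "\<And>c x y. x \<in> carrier A \<Longrightarrow> y \<in> carrier B \<Longrightarrow> f (c \<odot>\<^bsub>A\<^esub> x) y = c \<odot>\<^bsub>C\<^esub> f x y"
    and ft: "\<And>c x y. x \<in> carrier A \<Longrightarrow> y \<in> carrier B \<Longrightarrow> f x (c \<odot>\<^bsub>B\<^esub> y) = c \<odot>\<^bsub>C\<^esub> f x y"
  shows "tensor_lift C f \<in> algebra_hom (tensor_algebra A B) C"
    "\<And>x y. x \<in> carrier A \<Longrightarrow> y \<in> carrier B \<Longrightarrow> tensor_lift C f (tensor_elem A B x y) = f x y"
proof -
  interpret A: complex_algebra A by fact
  interpret B: complex_algebra B by fact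
  interpret C: complex_algebra C by fact
  interpret M: complex_algebra "monoid_algebra (A \<times>\<times> B)"
    by (rule monoid.complex_algebra_ma[OF monoid_prod[OF assms(1,2)]])
  let ?g = "\<lambda>(x,y). f x y"
  have h: "lin_ext C ?g \<in> algebra_hom (monoid_algebra (A \<times>\<times> B)) C"
    by (rule C.le_hom[OF monoid_prod[OF assms(1,2)]]) (auto simp: fc fm f1)
  have g: "?g \<in> (carrier A \<times> carrier B) \<rightarrow> carrier C" by (auto simp: fc)
  note add = C.le_add[OF g] and sm = C.le_smult[OF g] 
  have sg: "lin_ext C ?g (Poly_Mapping.single (x,y) c) = c \<odot>\<^bsub>C\<^esub> f x y" if "x \<in> carrier A" "y \<in> carrier B" for x y c
    using that by (subst C.le_single) (auto simp: fc)
  have keys: "Poly_Mapping.keys (Poly_Mapping.single (x,y) c) \<subseteq> carrier A \<times> carrier B" if "x \<in> carrier A" "y \<in> carrier B" for x y and c :: complex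
    using that by auto
  note d = keys_diff_sub
  have sub: "lin_ext C ?g (p - r) = lin_ext C ?g p \<ominus>\<^bsub>C\<^esub> lin_ext C ?g r"
    if "Poly_Mapping.keys p \<subseteq> carrier A \<times> carrier B" "Poly_Mapping.keys r \<subseteq> carrier A \<times> carrier B" for p r
  proof -
    have "lin_ext C ?g p = lin_ext C ?g (p - r) \<oplus>\<^bsub>C\<^esub> lin_ext C ?g r"
      using add[OF d[OF that] that(2)] by simp
    moreover have "lin_ext C ?g (p - r) \<in> carrier C" "lin_ext C ?g r \<in> carrier C" using C.le_closed[OF g] d that by blast+
    ultimately show ?thesis by (metis C.add.inv_solve_right C.minus_eq C.a_closed)
  qed
  have ax: "a \<oplus>\<^bsub>C\<^esub> (b \<oplus>\<^bsub>C\<^esub> (\<ominus>\<^bsub>C\<^esub> a \<oplus>\<^bsub>C\<^esub> \<ominus>\<^bsub>C\<^esub> b)) = \<zero>\<^bsub>C\<^esub>" if "a \<in> carrier C" "b \<in> carrier C" for a b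
    using that C.r_neg[of "a \<oplus>\<^bsub>C\<^esub> b"] by (simp add: C.minus_add C.a_assoc)
  have z: "lin_ext C ?g p = \<zero>\<^bsub>C\<^esub>" if "p \<in> bilinearity_relations A B" for p
    using that unfolding bilinearity_relations_def
    apply (auto simp: sub d keys sg fc fa fb fs ft C.smult_one C.smult_closed A.smult_closed B.smult_closed C.minus_eq C.minus_add simp del: keys_single)
    apply (simp_all add: C.a_ac fc C.r_neg C.r_neg1 C.r_neg2 C.smult_closed ax)
    done
  note * = M.coset_map_hom[OF bilin_sub[OF assms(1,2)] assms(3) h z, folded tensor_ideal_def]
  show "tensor_lift C f \<in> algebra_hom (tensor_algebra A B) C"
    unfolding tensor_lift_def tensor_algebra_def using *(1) by blast
  show "tensor_lift C f (tensor_elem A B x y) = f x y" if "x \<in> carrier A" "y \<in> carrier B" for x y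
    unfolding tensor_lift_def tensor_elem_def
    by (subst *(2)) (use that in \<open>auto simp: sg C.smult_one fc\<close>)
qed

lemma mat_alg: "complex_algebra (mat_algebra n)"
proof -
  interpret r: ring "ring_mat TYPE(complex) n ()" by (rule ring_mat)
  have e: "carrier (mat_algebra n) = carrier (ring_mat TYPE(complex) n ())"
      "monoid.mult (mat_algebra n) = monoid.mult (ring_mat TYPE(complex) n ())"
      "one (mat_algebra n) = one (ring_mat TYPE(complex) n ())"
      "zero (mat_algebra n) = zero (ring_mat TYPE(complex) n ())"
      "add (mat_algebra n) = add (ring_mat TYPE(complex) n ())"
    by (simp_all add: module_mat_def ring_mat_def)
  have "ring (mat_algebra n)"
  proof (rule ringI)
    show "abelian_group (mat_algebra n)"
    proof (rule abelian_groupI)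
      fix x assume "x \<in> carrier (mat_algebra n)"
      then show "\<exists>y\<in>carrier (mat_algebra n). y \<oplus>\<^bsub>mat_algebra n\<^esub> x = \<zero>\<^bsub>mat_algebra n\<^esub>"
        unfolding e by (intro bexI[of _ "\<ominus>\<^bsub>ring_mat TYPE(complex) n ()\<^esub> x"]) (simp_all add: r.l_neg)
    qed (simp_all add: e r.a_ac)
    show "Group.monoid (mat_algebra n)"
      by (rule monoidI) (simp_all add: e r.m_assoc)
  qed (simp_all add: e r.l_distr r.r_distr)
  then interpret ring "mat_algebra n" .
  show ?thesis
    by unfold_locales (auto simp: module_mat_def add_smult_distrib_right_mat add_smult_distrib_left_mat mult_smult_assoc_mat mult_smult_distrib intro!: eq_matI simp: algebra_simps)
qed

lemma free_monoid: "Group.monoid free_monoid" by (rule monoidI) (auto simp: free_monoid_def)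

lemma uq_relations_sub: "uq_relations q \<subseteq> carrier (monoid_algebra free_monoid)"
  by (simp add: free_monoid_def)

lemma Uq_alg: "complex_algebra (Uq q)" "ideal (uq_ideal q) (monoid_algebra free_monoid)"
proof -
  interpret M: complex_algebra "monoid_algebra (free_monoid :: uq_gen list monoid)"
    by (rule monoid.complex_algebra_ma[OF free_monoid])
  show "ideal (uq_ideal q) (monoid_algebra free_monoid)" unfolding uq_ideal_def
    by (rule M.genideal_ideal[OF uq_relations_sub])
  then show "complex_algebra (Uq q)" unfolding Uq_def by (rule M.quot_alg)
qed

lemma uq_lift:
  assumes "complex_algebra B" and phi: "\<And>g. \<phi> g \<in> carrier B"
    and "\<phi> GenK \<otimes>\<^bsub>B\<^esub> \<phi> GenKinv = \<one>\<^bsub>B\<^esub>" "\<phi> GenKinv \<otimes>\<^bsub>B\<^esub> \<phi> GenK = \<one>\<^bsub>B\<^esub>"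
    and "\<phi> GenK \<otimes>\<^bsub>B\<^esub> \<phi> GenE = q powi 2 \<odot>\<^bsub>B\<^esub> (\<phi> GenE \<otimes>\<^bsub>B\<^esub> \<phi> GenK)"
    and "\<phi> GenK \<otimes>\<^bsub>B\<^esub> \<phi> GenF = q powi (- 2) \<odot>\<^bsub>B\<^esub> (\<phi> GenF \<otimes>\<^bsub>B\<^esub> \<phi> GenK)"
    and EF: "\<phi> GenE \<otimes>\<^bsub>B\<^esub> \<phi> GenF \<ominus>\<^bsub>B\<^esub> \<phi> GenF \<otimes>\<^bsub>B\<^esub> \<phi> GenE
       = (1 / (q - inverse q)) \<odot>\<^bsub>B\<^esub> \<phi> GenK \<ominus>\<^bsub>B\<^esub> (1 / (q - inverse q)) \<odot>\<^bsub>B\<^esub> \<phi> GenKinv"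
  shows "uq_lift B \<phi> \<in> algebra_hom (Uq q) B" "uq_lift B \<phi> (uq_of_gen q g) = \<phi> g"
proof -
  interpret B: complex_algebra B by fact
  interpret M: complex_algebra "monoid_algebra (free_monoid :: uq_gen list monoid)"
    by (rule monoid.complex_algebra_ma[OF free_monoid])
  have wc: "word_eval B \<phi> w \<in> carrier B" for w
    by (induction w) (auto simp: word_eval_def phi)
  have wm: "word_eval B \<phi> (u @ v) = word_eval B \<phi> u \<otimes>\<^bsub>B\<^esub> word_eval B \<phi> v" for u v
    using wc by (induction u) (auto simp: word_eval_def phi B.m_assoc)
  have h: "lin_ext B (word_eval B \<phi>) \<in> algebra_hom (monoid_algebra free_monoid) B"
    by (rule B.le_hom[OF free_monoid]) (auto simp: free_monoid_def wc wm, simp add: word_eval_def)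
  have sg: "lin_ext B (word_eval B \<phi>) (Poly_Mapping.single w c) = c \<odot>\<^bsub>B\<^esub> word_eval B \<phi> w" for w c
    by (rule B.le_single) (rule wc)
  have g: "word_eval B \<phi> \<in> UNIV \<rightarrow> carrier B" using wc by auto
  have cl: "lin_ext B (word_eval B \<phi>) p \<in> carrier B" for p by (rule B.le_closed[OF g]) simp
  have add: "lin_ext B (word_eval B \<phi>) (p + r) = lin_ext B (word_eval B \<phi>) p \<oplus>\<^bsub>B\<^esub> lin_ext B (word_eval B \<phi>) r" for p r
    by (rule B.le_add[OF g]) auto
  have sub: "lin_ext B (word_eval B \<phi>) (p - r) = lin_ext B (word_eval B \<phi>) p \<ominus>\<^bsub>B\<^esub> lin_ext B (word_eval B \<phi>) r" for p r
  proof -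
    have "lin_ext B (word_eval B \<phi>) p = lin_ext B (word_eval B \<phi>) (p - r) \<oplus>\<^bsub>B\<^esub> lin_ext B (word_eval B \<phi>) r"
      using add[of "p - r" r] by simp
    then show ?thesis using cl by (metis B.add.inv_solve_right B.minus_eq)
  qed
  have w: "word_eval B \<phi> [a] = \<phi> a" "word_eval B \<phi> [a, b] = \<phi> a \<otimes>\<^bsub>B\<^esub> \<phi> b" "word_eval B \<phi> [] = \<one>\<^bsub>B\<^esub>" for a b
    by (simp_all add: word_eval_def phi)
  have ax: "a \<oplus>\<^bsub>B\<^esub> (b \<oplus>\<^bsub>B\<^esub> (\<ominus>\<^bsub>B\<^esub> a \<oplus>\<^bsub>B\<^esub> \<ominus>\<^bsub>B\<^esub> b)) = \<zero>\<^bsub>B\<^esub>" if "a \<in> carrier B" "b \<in> carrier B" for a b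
    using that B.r_neg[of "a \<oplus>\<^bsub>B\<^esub> b"] by (simp add: B.minus_add B.a_assoc)
  have z: "lin_ext B (word_eval B \<phi>) p = \<zero>\<^bsub>B\<^esub>" if "p \<in> uq_relations q" for p
    using that assms(3-6) phi unfolding uq_relations_def word_def
    apply (auto simp: add sub sg w EF B.smult_one B.smult_closed)
    apply (simp_all add: B.smult_closed B.minus_eq B.a_ac B.r_neg B.r_neg1 B.r_neg2 B.l_neg ax)
    done
  note * = M.coset_map_hom[OF uq_relations_sub assms(1) h z, folded uq_ideal_def]
  show "uq_lift B \<phi> \<in> algebra_hom (Uq q) B" unfolding uq_lift_def Uq_def using *(1) by blast
  show "uq_lift B \<phi> (uq_of_gen q g) = \<phi> g" unfolding uq_lift_def uq_of_gen_def word_def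
    by (subst *(2)) (simp_all add: sg w B.smult_one phi free_monoid_def)
qed
end

theory Submission
  imports Defs
begin

text \<open>
  Why the image of \<open>R\<close> intertwines the coproduct with its flip. Both sides of the claimed equation
  are algebra homomorphisms in \<open>Z\<close>, so it suffices to check generators (\<open>algebra_hom_Uq_eqI\<close>).
  There one writes \<open>R = D \<Theta>\<close> with the diagonal factor \<open>D\<close> (\<open>q\<close> to the power \<open>H \<otimes> H / 2\<close>) and the
  quasi-R-matrix \<open>\<Theta>\<close>, the sum over \<open>l < N\<close> of the terms \<open>c\<^sub>l E\<^sup>l \<otimes> F\<^sup>l\<close>.

  \<^item> \<open>\<Theta>\<close> intertwines \<open>\<Delta>(E) = E \<otimes> K + 1 \<otimes> E\<close> with \<open>1 \<otimes> E + E \<otimes> Ki\<close>, where \<open>Ki\<close> is the inverse of \<open>K\<close>,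
    and \<open>\<Delta>(F) = F \<otimes> 1 + Ki \<otimes> F\<close> with \<open>F \<otimes> 1 + K \<otimes> F\<close>. The difference of the two sides telescopes,
    because the bracket \<open>[E, F\<^sup>l\<^sup>+\<^sup>1]\<close> is a multiple of \<open>F\<^sup>l K - Ki F\<^sup>l\<close> and the coefficients \<open>c\<^sub>l\<close> satisfy
    the matching recursion (\<open>quasi_R_E\<close>, \<open>quasi_R_F\<close>, \<open>R_coeff_Suc\<close>).
  \<^item> Truncating the sum leaves a defect at \<open>l = N - 1\<close>. For \<open>F\<close> it contains \<open>F\<^sup>N = 0\<close>. For \<open>E\<close> it is a
    multiple of \<open>E\<^sup>N \<otimes> (F\<^sup>N\<^sup>-\<^sup>1 K - Ki F\<^sup>N\<^sup>-\<^sup>1)\<close>; the first factor is the nonzero scalar \<open>a\<close>, but the second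
    one vanishes in a semicyclic representation, because \<open>F\<^sup>N\<^sup>-\<^sup>1\<close> maps the only basis vector on which it
    is nonzero to a multiple of a basis vector of opposite weight (\<open>FF_top\<close>).
  \<^item> Conjugation by \<open>D\<close> turns the two intermediate elements into the flipped coproducts
    (\<open>R_diag_conj\<close>). When \<open>E\<close> or \<open>F\<close> passes from one end of the basis to the other, the weight jumps by an
    additional \<open>2 N\<close>; this has no effect because \<open>q\<^sup>2\<^sup>N = 1\<close> and all weights are even for odd \<open>N\<close>
    (\<open>phase_shift\<close>).

  The image of \<open>R\<close> is invertible since \<open>D\<close> is diagonal with nonzero entries and \<open>\<Theta>\<close> is \<open>1\<close> plus a multiple of
  the nilpotent \<open>E \<otimes> F\<close>.
\<close>


section \<open>Homomorphisms of complex algebras\<close>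

lemma algebra_hom_closed: "h \<in> algebra_hom A B \<Longrightarrow> x \<in> carrier A \<Longrightarrow> h x \<in> carrier B"
  by (auto simp: algebra_hom_def Ring.ring_hom_def)

lemma algebra_hom_mult:
  "h \<in> algebra_hom A B \<Longrightarrow> x \<in> carrier A \<Longrightarrow> y \<in> carrier A \<Longrightarrow> h (x \<otimes>\<^bsub>A\<^esub> y) = h x \<otimes>\<^bsub>B\<^esub> h y"
  by (auto simp: algebra_hom_def Ring.ring_hom_def)

lemma algebra_hom_add:
  "h \<in> algebra_hom A B \<Longrightarrow> x \<in> carrier A \<Longrightarrow> y \<in> carrier A \<Longrightarrow> h (x \<oplus>\<^bsub>A\<^esub> y) = h x \<oplus>\<^bsub>B\<^esub> h y"
  by (auto simp: algebra_hom_def Ring.ring_hom_def)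

lemma algebra_hom_one: "h \<in> algebra_hom A B \<Longrightarrow> h \<one>\<^bsub>A\<^esub> = \<one>\<^bsub>B\<^esub>"
  by (auto simp: algebra_hom_def Ring.ring_hom_def)

lemma algebra_hom_smult:
  "h \<in> algebra_hom A B \<Longrightarrow> x \<in> carrier A \<Longrightarrow> h (c \<odot>\<^bsub>A\<^esub> x) = c \<odot>\<^bsub>B\<^esub> h x"
  by (auto simp: algebra_hom_def)

lemmas algebra_hom_simps =
  algebra_hom_closed algebra_hom_mult algebra_hom_add algebra_hom_one algebra_hom_smult

lemma algebra_hom_compose:
  assumes "g \<in> algebra_hom A B" "h \<in> algebra_hom B C"
  shows "(\<lambda>x. h (g x)) \<in> algebra_hom A C"
  using algebra_hom_simps[OF assms(1)] algebra_hom_simps[OF assms(2)]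
  by (auto simp: algebra_hom_def[of A C] Ring.ring_hom_def[of A C])

lemma (in complex_algebra) conjugation_algebra_hom:
  assumes u: "u \<in> Units A"
  shows "(\<lambda>x. u \<otimes> x \<otimes> inv u) \<in> algebra_hom A A"
proof -
  have [simp]: "u \<in> carrier A" "inv u \<in> carrier A" using u by auto
  have cancel: "inv u \<otimes> (u \<otimes> x) = x" if "x \<in> carrier A" for x
    using that u by (simp add: m_assoc[symmetric])
  show ?thesis
    using u unfolding algebra_hom_def Ring.ring_hom_def
    by (auto simp: m_assoc cancel l_distr r_distr smult_mult_l smult_mult_r smult_closed)
qed

text \<open>
  The cosets of words span the algebra and are products of the generators, so a homomorphism is
  determined by its values on the generators.
\<close>

lemma algebra_hom_Uq_eqI:
  assumes B: "complex_algebra B"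
    and h: "h \<in> algebra_hom (Uq q) B" and h': "h' \<in> algebra_hom (Uq q) B"
    and gen: "\<And>g. h (uq_of_gen q g) = h' (uq_of_gen q g)"
    and Z: "Z \<in> carrier (Uq q)"
  shows "h Z = h' Z"
proof -
  interpret B: complex_algebra B by fact
  let ?M = "monoid_algebra (free_monoid :: uq_gen list monoid)"
  interpret M: complex_algebra ?M
    by (rule monoid.complex_algebra_ma[OF free_monoid])
  interpret U: complex_algebra "Uq q" by (rule Uq_alg)
  let ?\<pi> = "\<lambda>p. uq_ideal q +>\<^bsub>?M\<^esub> p"
  note Q = M.quot_simps[OF Uq_alg(2)[of q], folded Uq_def] M.quot_sm[OF Uq_alg(2)[of q], folded Uq_def]
  have car: "p \<in> carrier ?M" for p by (simp add: free_monoid_def)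
  have U: "?\<pi> p \<in> carrier (Uq q)" for p using Q(1) car by blast
  note hs = algebra_hom_simps[OF h] algebra_hom_simps[OF h']
  have word: "h (?\<pi> (word w)) = h' (?\<pi> (word w))" for w
  proof (induction w)
    case Nil
    have "?\<pi> (word []) = \<one>\<^bsub>Uq q\<^esub>" using Q(4) by (simp add: word_def free_monoid_def)
    then show ?case by (simp add: hs)
  next
    case (Cons g w)
    have "?\<pi> (word (g # w)) = uq_of_gen q g \<otimes>\<^bsub>Uq q\<^esub> ?\<pi> (word w)"
      unfolding uq_of_gen_def by (subst Q(2)) (simp_all add: car, simp_all add: word_def free_monoid_def)
    then show ?case using Cons gen[of g] U[of "word [g]"] by (simp add: hs U uq_of_gen_def)
  qed
  have "h (?\<pi> p) = h' (?\<pi> p)" for p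
  proof (induction p rule: pm_induct0)
    case zero
    have "?\<pi> (0 \<odot>\<^bsub>?M\<^esub> word []) = 0 \<odot>\<^bsub>Uq q\<^esub> ?\<pi> (word [])" using Q(6)[OF car] by simp
    moreover have "0 \<odot>\<^bsub>?M\<^esub> word [] = 0" by (simp add: word_def)
    ultimately show ?case using word[of "[]"] by (simp add: hs U)
  next
    case (step w c p)
    have "?\<pi> (Poly_Mapping.single w c + p) = ?\<pi> (c \<odot>\<^bsub>?M\<^esub> word w) \<oplus>\<^bsub>Uq q\<^esub> ?\<pi> p"
      using Q(3)[OF car car, of "c \<odot>\<^bsub>?M\<^esub> word w" p] by (simp add: word_def)
    also have "?\<pi> (c \<odot>\<^bsub>?M\<^esub> word w) = c \<odot>\<^bsub>Uq q\<^esub> ?\<pi> (word w)"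
      using Q(6)[OF car] by simp
    finally show ?case using step word by (simp add: hs U U.smult_closed)
  qed
  then show ?thesis using Z unfolding Q(1) by auto
qed

section \<open>Multiplicative bilinear maps and tensor products\<close>

text \<open>
  A bilinear map that is multiplicative on pairs, in other words a pair of homomorphisms
  \<open>A \<rightarrow> C\<close> and \<open>B \<rightarrow> C\<close> with commuting images. The universal map
  \<open>A \<times> B \<rightarrow> A \<otimes> B\<close> and the Kronecker product of matrices are both of this kind, so a computation
  made for an arbitrary pairing holds in \<open>U \<otimes> U\<close> (where it gives the coproduct) and in
  \<open>End (V \<otimes> V)\<close> (where it concerns the \<open>R\<close>-matrix).
\<close>

locale algebra_pairing =
  A: complex_algebra A + B: complex_algebra B + C: complex_algebra C
  for A :: "(complex, 'a) module" and B :: "(complex, 'b) module" and C :: "(complex, 'c) module" +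
  fixes f :: "'a \<Rightarrow> 'b \<Rightarrow> 'c"
  assumes closed [simp]: "x \<in> carrier A \<Longrightarrow> y \<in> carrier B \<Longrightarrow> f x y \<in> carrier C"
    and mult: "x \<in> carrier A \<Longrightarrow> y \<in> carrier B \<Longrightarrow> x' \<in> carrier A \<Longrightarrow> y' \<in> carrier B \<Longrightarrow>
        f x y \<otimes>\<^bsub>C\<^esub> f x' y' = f (x \<otimes>\<^bsub>A\<^esub> x') (y \<otimes>\<^bsub>B\<^esub> y')"
    and one: "f \<one>\<^bsub>A\<^esub> \<one>\<^bsub>B\<^esub> = \<one>\<^bsub>C\<^esub>"
    and add_left: "x \<in> carrier A \<Longrightarrow> y \<in> carrier B \<Longrightarrow> x' \<in> carrier A \<Longrightarrow>
        f (x \<oplus>\<^bsub>A\<^esub> x') y = f x y \<oplus>\<^bsub>C\<^esub> f x' y"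
    and add_right: "x \<in> carrier A \<Longrightarrow> y \<in> carrier B \<Longrightarrow> y' \<in> carrier B \<Longrightarrow>
        f x (y \<oplus>\<^bsub>B\<^esub> y') = f x y \<oplus>\<^bsub>C\<^esub> f x y'"
    and smult_left: "x \<in> carrier A \<Longrightarrow> y \<in> carrier B \<Longrightarrow> f (c \<odot>\<^bsub>A\<^esub> x) y = c \<odot>\<^bsub>C\<^esub> f x y"
    and smult_right: "x \<in> carrier A \<Longrightarrow> y \<in> carrier B \<Longrightarrow> f x (c \<odot>\<^bsub>B\<^esub> y) = c \<odot>\<^bsub>C\<^esub> f x y"
begin

lemma tensor_lift_hom: "tensor_lift C f \<in> algebra_hom (tensor_algebra A B) C"
  by (rule tensor_lift(1))
    (simp_all add: A.complex_algebra_axioms B.complex_algebra_axioms C.complex_algebra_axioms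
      mult one add_left add_right smult_left smult_right)

lemma tensor_lift_elem:
  "x \<in> carrier A \<Longrightarrow> y \<in> carrier B \<Longrightarrow> tensor_lift C f (tensor_elem A B x y) = f x y"
  by (rule tensor_lift(2))
    (simp_all add: A.complex_algebra_axioms B.complex_algebra_axioms C.complex_algebra_axioms
      mult one add_left add_right smult_left smult_right)

lemma flip: "algebra_pairing B A C (\<lambda>y x. f x y)"
  by unfold_locales (simp_all add: mult one add_left add_right smult_left smult_right)

lemma pullback:
  assumes A': "complex_algebra A'" and B': "complex_algebra B'"
    and g: "g \<in> algebra_hom A' A" and h: "h \<in> algebra_hom B' B"
  shows "algebra_pairing A' B' C (\<lambda>x y. f (g x) (h y))"
proof -
  interpret A': complex_algebra A' by fact
  interpret B': complex_algebra B' by fact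
  note gh = algebra_hom_simps[OF g] algebra_hom_simps[OF h]
  show ?thesis
    by unfold_locales
      (simp_all add: gh mult one add_left add_right smult_left smult_right)
qed

end

lemma (in ideal) coset_eqI:
  assumes "x \<in> carrier R" "y \<in> carrier R" "x \<ominus> y \<in> I"
  shows "I +> x = I +> y"
  using assms quotient_eq_iff_same_a_r_cos[OF ideal_axioms] by metis

text \<open>
  Makes a defining relation an equation in the quotient: the algebra subtraction of the monoid
  algebra is the subtraction of finitely supported functions.
\<close>

lemma monoid_algebra_coset_eqI:
  assumes M: "Group.monoid M" and S: "S \<subseteq> carrier (monoid_algebra M)"
    and p: "p \<in> carrier (monoid_algebra M)" and r: "r \<in> carrier (monoid_algebra M)"
    and diff: "p - r \<in> S"
  shows "Idl\<^bsub>monoid_algebra M\<^esub> S +>\<^bsub>monoid_algebra M\<^esub> p = Idl\<^bsub>monoid_algebra M\<^esub> S +>\<^bsub>monoid_algebra M\<^esub> r"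
proof -
  interpret M: complex_algebra "monoid_algebra M" by (rule monoid.complex_algebra_ma[OF M])
  interpret I: ideal "Idl\<^bsub>monoid_algebra M\<^esub> S" "monoid_algebra M" by (rule M.genideal_ideal[OF S])
  have "p - r \<in> carrier (monoid_algebra M)" using diff S by blast
  moreover have "p = (p - r) \<oplus>\<^bsub>monoid_algebra M\<^esub> r" by simp
  ultimately have "p \<ominus>\<^bsub>monoid_algebra M\<^esub> r = p - r"
    using p r by (metis M.add.inv_solve_right M.minus_eq)
  then show ?thesis using p r diff M.genideal_self[OF S] by (intro I.coset_eqI) auto
qed

lemma tensor_elem_pairing:
  assumes A: "complex_algebra A" and B: "complex_algebra B"
  shows "algebra_pairing A B (tensor_algebra A B) (tensor_elem A B)"
proof -
  interpret A: complex_algebra A by fact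
  interpret B: complex_algebra B by fact
  let ?M = "monoid_algebra (A \<times>\<times> B)"
  interpret M: complex_algebra ?M
    by (rule monoid.complex_algebra_ma[OF monoid_prod[OF A B]])
  interpret T: complex_algebra "tensor_algebra A B" by (rule tensor_alg[OF A B])
  interpret I: ideal "tensor_ideal A B" ?M by (rule tensor_alg[OF A B])
  note Q = M.quot_simps[OF I.ideal_axioms, folded tensor_algebra_def]
    M.quot_sm[OF I.ideal_axioms, folded tensor_algebra_def]
  let ?s = "\<lambda>x y c. Poly_Mapping.single (x, y) (c :: complex)"
  have car: "?s x y c \<in> carrier ?M" if "x \<in> carrier A" "y \<in> carrier B" for x y c
    using that by simp
  have eqI: "tensor_ideal A B +>\<^bsub>?M\<^esub> p = tensor_ideal A B +>\<^bsub>?M\<^esub> r"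
    if "p \<in> carrier ?M" "r \<in> carrier ?M" "p - r \<in> bilinearity_relations A B" for p r
    unfolding tensor_ideal_def
    by (rule monoid_algebra_coset_eqI[OF monoid_prod[OF A B] bilin_sub[OF A B] that])
  have te: "tensor_elem A B x y = tensor_ideal A B +>\<^bsub>?M\<^esub> ?s x y 1" for x y
    by (simp add: tensor_elem_def)
  show ?thesis
  proof (unfold_locales, goal_cases)
    case (1 x y)
    then show ?case unfolding te Q(1) using car by blast
  next
    case (2 x y x' y')
    then show ?case unfolding te by (subst Q(2)[OF car car]) simp_all
  next
    case 3
    show ?case unfolding te Q(4) by simp
  next
    case (4 x y x')
    have "tensor_elem A B x y \<oplus>\<^bsub>tensor_algebra A B\<^esub> tensor_elem A B x' y
        = tensor_ideal A B +>\<^bsub>?M\<^esub> (?s x y 1 + ?s x' y 1)"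
      unfolding te using 4 by (subst Q(3)[OF car car]) simp_all
    also have "\<dots> = tensor_elem A B (x \<oplus>\<^bsub>A\<^esub> x') y"
      unfolding te
    proof (rule sym, rule eqI)
      show "?s x y 1 + ?s x' y 1 \<in> carrier ?M"
        using M.a_closed[OF car car, of x y x' y 1 1] 4 by simp
      show "?s (x \<oplus>\<^bsub>A\<^esub> x') y 1 - (?s x y 1 + ?s x' y 1) \<in> bilinearity_relations A B"
        unfolding bilinearity_relations_def diff_diff_eq[symmetric] using 4 by blast
    qed (use 4 in \<open>simp add: car\<close>)
    finally show ?case ..
  next
    case (5 x y y')
    have "tensor_elem A B x y \<oplus>\<^bsub>tensor_algebra A B\<^esub> tensor_elem A B x y'
        = tensor_ideal A B +>\<^bsub>?M\<^esub> (?s x y 1 + ?s x y' 1)"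
      unfolding te using 5 by (subst Q(3)[OF car car]) simp_all
    also have "\<dots> = tensor_elem A B x (y \<oplus>\<^bsub>B\<^esub> y')"
      unfolding te
    proof (rule sym, rule eqI)
      show "?s x y 1 + ?s x y' 1 \<in> carrier ?M"
        using M.a_closed[OF car car, of x y x y' 1 1] 5 by simp
      show "?s x (y \<oplus>\<^bsub>B\<^esub> y') 1 - (?s x y 1 + ?s x y' 1) \<in> bilinearity_relations A B"
        unfolding bilinearity_relations_def diff_diff_eq[symmetric] using 5 by blast
    qed (use 5 in \<open>simp add: car\<close>)
    finally show ?case ..
  next
    case (6 x y c)
    have "c \<odot>\<^bsub>tensor_algebra A B\<^esub> tensor_elem A B x y = tensor_ideal A B +>\<^bsub>?M\<^esub> ?s x y c"
      unfolding te using 6 by (subst Q(6)[OF car]) simp_all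
    also have "\<dots> = tensor_elem A B (c \<odot>\<^bsub>A\<^esub> x) y"
      unfolding te
    proof (rule sym, rule eqI)
      show "?s (c \<odot>\<^bsub>A\<^esub> x) y 1 - ?s x y c \<in> bilinearity_relations A B"
        unfolding bilinearity_relations_def using 6 by blast
    qed (use 6 in \<open>simp_all add: car A.smult_closed\<close>)
    finally show ?case ..
  next
    case (7 x y c)
    have "c \<odot>\<^bsub>tensor_algebra A B\<^esub> tensor_elem A B x y = tensor_ideal A B +>\<^bsub>?M\<^esub> ?s x y c"
      unfolding te using 7 by (subst Q(6)[OF car]) simp_all
    also have "\<dots> = tensor_elem A B x (c \<odot>\<^bsub>B\<^esub> y)"
      unfolding te
    proof (rule sym, rule eqI)
      show "?s x (c \<odot>\<^bsub>B\<^esub> y) 1 - ?s x y c \<in> bilinearity_relations A B"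
        unfolding bilinearity_relations_def using 7 by blast
    qed (use 7 in \<open>simp_all add: car B.smult_closed\<close>)
    finally show ?case ..
  qed
qed

section \<open>Representations of the quantum group\<close>

text \<open>
  Elements of an algebra that satisfy the defining relations of the quantum group, so that they define a
  homomorphism from \<open>U\<^sub>q(sl\<^sub>2)\<close>. The relation between \<open>E\<close> and \<open>F\<close> is solved for \<open>E F\<close>, which
  makes it a rewrite rule and avoids subtraction in the abstract ring.
\<close>

locale uq_elements = complex_algebra A for A :: "(complex, 'a) module" (structure) +
  fixes q :: complex and K Ki E F :: 'a
  assumes q0: "q \<noteq> 0" and q2: "q\<^sup>2 \<noteq> 1"
    and in_carrier [simp]: "K \<in> carrier A" "Ki \<in> carrier A" "E \<in> carrier A" "F \<in> carrier A"
    and K_Ki: "K \<otimes> Ki = \<one>" and Ki_K: "Ki \<otimes> K = \<one>"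
    and K_E: "K \<otimes> E = q powi 2 \<odot> (E \<otimes> K)"
    and K_F: "K \<otimes> F = q powi (- 2) \<odot> (F \<otimes> K)"
    and E_F: "E \<otimes> F = F \<otimes> E \<oplus> ((1 / (q - inverse q)) \<odot> K \<oplus> (- 1 / (q - inverse q)) \<odot> Ki)"
begin

lemmas sm_simps = smult_closed smult_mult_l smult_mult_r smult_assoc[symmetric] smult_l_distr
  smult_r_distr

lemma K_Ki_left: "x \<in> carrier A \<Longrightarrow> K \<otimes> (Ki \<otimes> x) = x"
  "x \<in> carrier A \<Longrightarrow> Ki \<otimes> (K \<otimes> x) = x"
  by (simp_all add: m_assoc[symmetric] K_Ki Ki_K)

lemma Ki_commutes:
  assumes x: "x \<in> carrier A" and c: "c \<noteq> 0" and K: "K \<otimes> x = c \<odot> (x \<otimes> K)"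
  shows "Ki \<otimes> x = inverse c \<odot> (x \<otimes> Ki)"
proof -
  have "x = Ki \<otimes> (K \<otimes> x) " using x by (simp add: K_Ki_left)
  also have "\<dots> = c \<odot> (Ki \<otimes> x \<otimes> K)" using x by (simp add: K sm_simps m_assoc)
  finally have "inverse c \<odot> (x \<otimes> Ki) = inverse c \<odot> (c \<odot> (Ki \<otimes> x \<otimes> K) \<otimes> Ki)" by simp
  also have "\<dots> = Ki \<otimes> x" using x c by (simp add: sm_simps m_assoc K_Ki smult_one)
  finally show ?thesis ..
qed

lemma Ki_E: "Ki \<otimes> E = q powi (- 2) \<odot> (E \<otimes> Ki)"
  using Ki_commutes[OF _ _ K_E] q0 by (simp add: power_int_minus)

lemma Ki_F: "Ki \<otimes> F = q powi 2 \<odot> (F \<otimes> Ki)"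
  using Ki_commutes[OF _ _ K_F] q0 by (simp add: power_int_minus)

lemma commute_pow:
  assumes k: "k \<in> carrier A" and x: "x \<in> carrier A" and kx: "k \<otimes> x = c \<odot> (x \<otimes> k)"
  shows "k \<otimes> x [^] (n::nat) = c ^ n \<odot> (x [^] n \<otimes> k)"
proof (induction n)
  case (Suc n)
  have "k \<otimes> x [^] Suc n = k \<otimes> x [^] n \<otimes> x" using k x by (simp add: m_assoc)
  also have "\<dots> = c ^ n \<odot> (x [^] n \<otimes> (k \<otimes> x))" using k x by (simp add: Suc sm_simps m_assoc)
  also have "\<dots> = c ^ Suc n \<odot> (x [^] Suc n \<otimes> k)" using k x by (simp add: kx sm_simps m_assoc mult.commute)
  finally show ?case .
qed (use k in \<open>simp add: smult_one\<close>)

text \<open>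
  This is \<open>[n + 1] q\<^sup>-\<^sup>n / (q - q\<^sup>-\<^sup>1)\<close>, the coefficient of the commutators \<open>[E, F\<^sup>n\<^sup>+\<^sup>1]\<close>
  and \<open>[E\<^sup>n\<^sup>+\<^sup>1, F]\<close>.
\<close>

definition comm_coeff :: "nat \<Rightarrow> complex" where
  "comm_coeff n = (q - inverse q ^ (2 * n + 1)) / (q - inverse q)\<^sup>2"

lemma q_minus_inverse: "q - inverse q \<noteq> 0"
  using q0 q2 by (auto simp: field_simps power2_eq_square)

lemma comm_coeff_0: "comm_coeff 0 = 1 / (q - inverse q)"
  using q_minus_inverse by (simp add: comm_coeff_def power2_eq_square)

text \<open>
  Both \<open>F\<^sup>n K F\<close> and \<open>F\<^sup>n\<^sup>+\<^sup>1 Ki\<close> have to be brought into the two forms that occur in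
  \<open>[E, F\<^sup>n\<^sup>+\<^sup>1]\<close>; the two equations are what remains of the induction step after this.
\<close>

lemma comm_coeff_Suc:
  "comm_coeff n * q powi (- 2) + 1 / (q - inverse q) = comm_coeff (Suc n)"
  "comm_coeff n + inverse q ^ (2 * n + 2) / (q - inverse q) = comm_coeff (Suc n)"
proof -
  define p where "p = inverse q"
  define u where "u = 1 / (q - p)"
  have p: "q * p = 1" using q0 by (simp add: p_def)
  have u: "u * (q - p) = 1" using q_minus_inverse by (simp add: u_def p_def)
  have c: "comm_coeff n = u\<^sup>2 * (q - p ^ (2 * n + 1))" for n
    by (simp add: comm_coeff_def u_def p_def power_divide)
  have m2: "q powi (- 2) = p\<^sup>2" by (simp add: p_def power_int_minus power_inverse)
  have p2: "q * p\<^sup>2 = p" using p by (simp add: power2_eq_square)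
  have key: "u\<^sup>2 * (q - p) = u" by (simp add: power2_eq_square mult.assoc u)
  have "u\<^sup>2 * (q - p ^ (2 * n + 1)) * p\<^sup>2 + u
      = u\<^sup>2 * (q * p\<^sup>2 - p ^ (2 * Suc n + 1)) + u\<^sup>2 * (q - p)"
    unfolding key by (simp add: algebra_simps power_add power2_eq_square)
  also have "\<dots> = u\<^sup>2 * (q - p ^ (2 * Suc n + 1))"
    unfolding p2 by (simp add: algebra_simps)
  finally show "comm_coeff n * q powi (- 2) + 1 / (q - inverse q) = comm_coeff (Suc n)"
    unfolding c m2 by (simp add: u_def p_def)
  have "u\<^sup>2 * (q - p ^ (2 * n + 1)) + p ^ (2 * n + 2) * u
      = u\<^sup>2 * (q - p ^ (2 * n + 1)) + p ^ (2 * n + 2) * (u\<^sup>2 * (q - p))"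
    by (simp add: key)
  also have "\<dots> = u\<^sup>2 * (q - p ^ (2 * n + 1) + p ^ (2 * n + 1) * (q * p) - p ^ (2 * Suc n + 1))"
    by (simp add: algebra_simps power_add power2_eq_square)
  also have "\<dots> = u\<^sup>2 * (q - p ^ (2 * Suc n + 1))" by (simp add: p)
  finally show "comm_coeff n + inverse q ^ (2 * n + 2) / (q - inverse q) = comm_coeff (Suc n)"
    unfolding c by (simp add: u_def p_def)
qed

lemma smult_combine: 
  assumes "x \<in> carrier A" "c + d = e" shows "c \<odot> x \<oplus> d \<odot> x = e \<odot> x"
  using assms smult_l_distr by metis

text \<open>
  The bracket is left in the unsorted form \<open>F\<^sup>n K - Ki F\<^sup>n\<close>, because the commutator of a term of
  the quasi-R-matrix with the rest of the coproduct produces exactly this combination.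
\<close>

lemma E_F_pow:
  "E \<otimes> F [^] Suc n = F [^] Suc n \<otimes> E
     \<oplus> (comm_coeff n \<odot> (F [^] n \<otimes> K) \<oplus> (- comm_coeff n) \<odot> (Ki \<otimes> F [^] n))"
proof (induction n)
  case 0
  show ?case by (simp add: E_F comm_coeff_0)
next
  case (Suc n)
  let ?u = "1 / (q - inverse q)" and ?F = "F [^] Suc n"
  have F: "?F \<in> carrier A" by (simp del: nat_pow_Suc)
  have Ki: "?F \<otimes> Ki = inverse q ^ (2 * n + 2) \<odot> (Ki \<otimes> ?F)"
    using commute_pow[OF _ _ Ki_F, of "Suc n"] q0
    by (simp add: sm_simps power_mult[symmetric] power_inverse smult_one flip: power_mult_distrib del: nat_pow_Suc power_Suc)
  have "E \<otimes> F [^] Suc (Suc n) = (E \<otimes> ?F) \<otimes> F"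
    by (simp add: m_assoc)
  also have "\<dots> = ?F \<otimes> (E \<otimes> F) \<oplus> (comm_coeff n \<odot> (F [^] n \<otimes> (K \<otimes> F)) \<oplus> (- comm_coeff n) \<odot> (Ki \<otimes> ?F))"
    unfolding Suc by (simp add: sm_simps m_assoc l_distr)
  also have "F [^] n \<otimes> (K \<otimes> F) = q powi (- 2) \<odot> (?F \<otimes> K)"
    by (simp add: K_F sm_simps m_assoc)
  also have "?F \<otimes> (E \<otimes> F) = F [^] Suc (Suc n) \<otimes> E \<oplus> (?u \<odot> (?F \<otimes> K) \<oplus> (- ?u) \<odot> (?F \<otimes> Ki))"
    unfolding E_F using F by (simp add: sm_simps m_assoc r_distr)
  also have "(- ?u) \<odot> (?F \<otimes> Ki) = (- ?u * inverse q ^ (2 * n + 2)) \<odot> (Ki \<otimes> ?F)"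
    using F unfolding Ki by (simp add: sm_simps del: nat_pow_Suc)
  also have "F [^] Suc (Suc n) \<otimes> E \<oplus> (?u \<odot> (?F \<otimes> K) \<oplus> (- ?u * inverse q ^ (2 * n + 2)) \<odot> (Ki \<otimes> ?F))
      \<oplus> (comm_coeff n \<odot> (q powi (- 2) \<odot> (?F \<otimes> K)) \<oplus> (- comm_coeff n) \<odot> (Ki \<otimes> ?F))
    = F [^] Suc (Suc n) \<otimes> E \<oplus> ((?u \<odot> (?F \<otimes> K) \<oplus> (comm_coeff n * q powi (- 2)) \<odot> (?F \<otimes> K))
      \<oplus> ((- ?u * inverse q ^ (2 * n + 2)) \<odot> (Ki \<otimes> ?F) \<oplus> (- comm_coeff n) \<odot> (Ki \<otimes> ?F)))"
    using F by (simp add: a_ac smult_closed smult_assoc del: nat_pow_Suc)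
  also have "?u \<odot> (?F \<otimes> K) \<oplus> (comm_coeff n * q powi (- 2)) \<odot> (?F \<otimes> K) = comm_coeff (Suc n) \<odot> (?F \<otimes> K)"
    using F comm_coeff_Suc(1)[of n] by (intro smult_combine) (simp_all add: add.commute)
  also have "(- ?u * inverse q ^ (2 * n + 2)) \<odot> (Ki \<otimes> ?F) \<oplus> (- comm_coeff n) \<odot> (Ki \<otimes> ?F)
      = (- comm_coeff (Suc n)) \<odot> (Ki \<otimes> ?F)"
    using F comm_coeff_Suc(2)[of n] by (intro smult_combine) (simp_all add: algebra_simps)
  finally show ?case .
qed

lemma E_pow_F:
  "E [^] Suc n \<otimes> F = F \<otimes> E [^] Suc n
     \<oplus> (comm_coeff n \<odot> (K \<otimes> E [^] n) \<oplus> (- comm_coeff n) \<odot> (E [^] n \<otimes> Ki))"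
proof (induction n)
  case 0
  show ?case by (simp add: E_F comm_coeff_0)
next
  case (Suc n)
  let ?u = "1 / (q - inverse q)" and ?E = "E [^] Suc n"
  have EE: "E \<otimes> E [^] n = E [^] Suc n" for n :: nat by (rule nat_pow_Suc2[symmetric]) simp
  have E: "?E \<in> carrier A" by (simp del: nat_pow_Suc)
  have K: "K \<otimes> ?E = q powi 2 \<odot> (E \<otimes> (K \<otimes> E [^] n))"
    unfolding EE[symmetric] by (simp add: m_assoc[symmetric] K_E sm_simps)
  have K': "E \<otimes> (K \<otimes> E [^] n) = q powi (- 2) \<odot> (K \<otimes> ?E)"
    unfolding K using q0 by (simp add: sm_simps power_int_minus smult_one)
  have Ki: "Ki \<otimes> ?E = inverse q ^ (2 * n + 2) \<odot> (?E \<otimes> Ki)"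
    using commute_pow[OF _ _ Ki_E, of "Suc n"] q0
    by (simp add: power_mult[symmetric] power_int_minus power_inverse del: nat_pow_Suc power_Suc)
  have "E [^] Suc (Suc n) \<otimes> F = E \<otimes> (?E \<otimes> F)"
    unfolding EE[of "Suc n", symmetric] using E by (simp add: m_assoc del: nat_pow_Suc)
  also have "\<dots> = (E \<otimes> F) \<otimes> ?E
      \<oplus> (comm_coeff n \<odot> (E \<otimes> (K \<otimes> E [^] n)) \<oplus> (- comm_coeff n) \<odot> (?E \<otimes> Ki))"
    unfolding Suc using E by (simp add: sm_simps m_assoc[symmetric] r_distr EE del: nat_pow_Suc)
  also have "(E \<otimes> F) \<otimes> ?E = F \<otimes> E [^] Suc (Suc n) \<oplus> (?u \<odot> (K \<otimes> ?E) \<oplus> (- ?u) \<odot> (Ki \<otimes> ?E))"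
    unfolding E_F EE[of "Suc n", symmetric] using E by (simp add: sm_simps m_assoc l_distr del: nat_pow_Suc)
  also have "(- ?u) \<odot> (Ki \<otimes> ?E) = (- ?u * inverse q ^ (2 * n + 2)) \<odot> (?E \<otimes> Ki)"
    using E unfolding Ki by (simp add: sm_simps del: nat_pow_Suc)
  also have "F \<otimes> E [^] Suc (Suc n) \<oplus> (?u \<odot> (K \<otimes> ?E) \<oplus> (- ?u * inverse q ^ (2 * n + 2)) \<odot> (?E \<otimes> Ki))
      \<oplus> (comm_coeff n \<odot> (E \<otimes> (K \<otimes> E [^] n)) \<oplus> (- comm_coeff n) \<odot> (?E \<otimes> Ki))
    = F \<otimes> E [^] Suc (Suc n) \<oplus> ((?u \<odot> (K \<otimes> ?E) \<oplus> (comm_coeff n * q powi (- 2)) \<odot> (K \<otimes> ?E))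
      \<oplus> ((- ?u * inverse q ^ (2 * n + 2)) \<odot> (?E \<otimes> Ki) \<oplus> (- comm_coeff n) \<odot> (?E \<otimes> Ki)))"
    unfolding K' using E by (simp add: a_ac smult_closed smult_assoc del: nat_pow_Suc)
  also have "?u \<odot> (K \<otimes> ?E) \<oplus> (comm_coeff n * q powi (- 2)) \<odot> (K \<otimes> ?E) = comm_coeff (Suc n) \<odot> (K \<otimes> ?E)"
    using E comm_coeff_Suc(1)[of n] by (intro smult_combine) (simp_all add: add.commute)
  also have "(- ?u * inverse q ^ (2 * n + 2)) \<odot> (?E \<otimes> Ki) \<oplus> (- comm_coeff n) \<odot> (?E \<otimes> Ki)
      = (- comm_coeff (Suc n)) \<odot> (?E \<otimes> Ki)"
    using E comm_coeff_Suc(2)[of n] by (intro smult_combine) (simp_all add: algebra_simps)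
  finally show ?case .
qed

definition gens :: "uq_gen \<Rightarrow> 'a" where
  "gens g = (case g of GenK \<Rightarrow> K | GenKinv \<Rightarrow> Ki | GenE \<Rightarrow> E | GenF \<Rightarrow> F)"

lemma EF_diff: 
  "E \<otimes> F \<ominus> F \<otimes> E = (1 / (q - inverse q)) \<odot> K \<ominus> (1 / (q - inverse q)) \<odot> Ki"
proof -
  let ?u = "1 / (q - inverse q)"
  have neg: "(- ?u) \<odot> Ki = \<ominus> (?u \<odot> Ki)"
  proof -
    have "(- ?u) \<odot> Ki \<oplus> ?u \<odot> Ki = \<zero>"
      by (simp add: smult_l_distr[symmetric] zero_sm)
    then show ?thesis by (simp add: minus_equality smult_closed)
  qed
  have "E \<otimes> F = F \<otimes> E \<oplus> (?u \<odot> K \<ominus> ?u \<odot> Ki)"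
    using E_F neg by (simp add: minus_eq)
  then show ?thesis
    by (simp add: minus_eq a_ac smult_closed r_neg1 r_neg2)
qed

lemma lift_hom:
  shows "uq_lift A gens \<in> algebra_hom (Uq q) A" "uq_lift A gens (uq_of_gen q g) = gens g"
proof -
  have "gens g \<in> carrier A" for g by (cases g) (simp_all add: gens_def)
  note * = uq_lift[OF complex_algebra_axioms, of gens q, OF this]
  show "uq_lift A gens \<in> algebra_hom (Uq q) A" "uq_lift A gens (uq_of_gen q g) = gens g"
    by (rule *; simp add: gens_def K_Ki Ki_K K_E K_F EF_diff del: power_int_minus)+
qed

end

text \<open>
  The generators of the presented algebra satisfy its relations, so what is proved for
  \<open>uq_elements\<close> applies to the algebra itself.
\<close>

lemma Uq_elements:
  assumes q: "q \<noteq> 0" "q\<^sup>2 \<noteq> 1"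
  shows "uq_elements (Uq q) q (uq_of_gen q GenK) (uq_of_gen q GenKinv) (uq_of_gen q GenE) (uq_of_gen q GenF)"
proof -
  let ?M = "monoid_algebra (free_monoid :: uq_gen list monoid)"
  interpret M: complex_algebra ?M
    by (rule monoid.complex_algebra_ma[OF free_monoid])
  interpret U: complex_algebra "Uq q" by (rule Uq_alg)
  let ?\<pi> = "\<lambda>p. uq_ideal q +>\<^bsub>?M\<^esub> p" and ?u = "1 / (q - inverse q)"
  note Q = M.quot_simps[OF Uq_alg(2)[of q], folded Uq_def] M.quot_sm[OF Uq_alg(2)[of q], folded Uq_def]
  have car: "p \<in> carrier ?M" for p by (simp add: free_monoid_def)
  have relI: "?\<pi> p = ?\<pi> r" if "p - r \<in> uq_relations q" for p r
    unfolding uq_ideal_def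
    by (rule monoid_algebra_coset_eqI[OF free_monoid uq_relations_sub car car that])
  have mult: "?\<pi> (word v) \<otimes>\<^bsub>Uq q\<^esub> ?\<pi> (word w) = ?\<pi> (word (v @ w))" for v w
    by (subst Q(2)[OF car car]) (simp add: word_def free_monoid_def)
  have smult: "c \<odot>\<^bsub>Uq q\<^esub> ?\<pi> (word w) = ?\<pi> (Poly_Mapping.single w c)" for c w
    by (subst Q(6)[OF car]) (simp add: word_def)
  have add: "?\<pi> p \<oplus>\<^bsub>Uq q\<^esub> ?\<pi> r = ?\<pi> (p + r)" for p r
    by (subst Q(3)[OF car car]) simp
  have one: "\<one>\<^bsub>Uq q\<^esub> = ?\<pi> (word [])" using Q(4) by (simp add: word_def free_monoid_def)
  show ?thesis
  proof (unfold_locales, goal_cases)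
    case 1 show ?case by (rule q)
  next case 2 show ?case by (rule q)
  next case 7 show ?case
      unfolding uq_of_gen_def mult one by (rule relI) (simp add: uq_relations_def)
  next case 8 show ?case
      unfolding uq_of_gen_def mult one by (rule relI) (simp add: uq_relations_def)
  next case 9 show ?case
      unfolding uq_of_gen_def mult smult by (rule relI) (simp add: uq_relations_def)
  next case 10 show ?case
      unfolding uq_of_gen_def mult smult by (rule relI) (simp add: uq_relations_def)
  next case 11
    have "word [GenE, GenF] - (word [GenF, GenE]
        + (Poly_Mapping.single [GenK] ?u + Poly_Mapping.single [GenKinv] (- 1 / (q - inverse q))))
      = word [GenE, GenF] - word [GenF, GenE]
        - Poly_Mapping.single [GenK] ?u + Poly_Mapping.single [GenKinv] ?u"
      by (simp add: single_uminus algebra_simps)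
    then show ?case
      unfolding uq_of_gen_def mult smult add by (intro relI) (simp add: uq_relations_def)
  qed (unfold uq_of_gen_def Q(1), (rule imageI, rule car)+)
qed

section \<open>The coproduct and the quasi-R-matrix\<close>

lemma (in complex_algebra) one_minus_nilpotent_Unit:
  assumes x: "x \<in> carrier A" and nil: "x [^] (n::nat) = \<zero>"
  shows "\<one> \<ominus> x \<in> Units A"
proof -
  define g where "g n = (\<Oplus>l\<in>{0..<n}. x [^] l)" for n :: nat
  have g [simp]: "g n \<in> carrier A" for n unfolding g_def using x by (intro finsum_closed) auto
  have g0: "g 0 = \<zero>" by (simp add: g_def)
  have gS: "g (Suc n) = x [^] n \<oplus> g n" for n
    unfolding g_def by (subst atLeast0_lessThan_Suc) (use x in \<open>auto simp: Pi_iff\<close>)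
  have left: "(\<one> \<ominus> x) \<otimes> g n = \<one> \<ominus> x [^] n" for n
  proof (induction n)
    case 0 then show ?case using x by (simp add: g0 minus_eq r_neg)
  next
    case (Suc n)
    have "(\<one> \<ominus> x) \<otimes> g (Suc n) = (\<one> \<ominus> x) \<otimes> x [^] n \<oplus> (\<one> \<ominus> x [^] n)"
      unfolding gS using x Suc by (simp add: r_distr)
    also have "\<dots> = \<one> \<ominus> x [^] Suc n"
      using x by (simp add: minus_eq l_distr l_minus a_ac r_neg r_neg1 r_neg2 nat_pow_Suc2[symmetric] del: nat_pow_Suc)
    finally show ?case .
  qed
  have comm: "x \<otimes> g n = g n \<otimes> x" for n
  proof (induction n)
    case (Suc n)
    then show ?case unfolding gS using x by (simp add: l_distr r_distr nat_pow_Suc2[symmetric])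
  qed (use x in \<open>simp add: g0\<close>)
  have right: "g n \<otimes> (\<one> \<ominus> x) = (\<one> \<ominus> x) \<otimes> g n" for n
    using x comm[of n] by (simp add: minus_eq l_distr r_distr l_minus r_minus)
  have "(\<one> \<ominus> x) \<otimes> g n = \<one>" using left[of n] nil by (simp add: minus_eq)
  then show ?thesis using x right[of n] unfolding Units_def by (auto intro!: bexI[of _ "g n"])
qed

text \<open>
  The polynomial is \<open>1 - T P\<close>, where \<open>P\<close> is a polynomial in \<open>T\<close> and commutes with it; hence
  \<open>T P\<close> is nilpotent.
\<close>

lemma (in complex_algebra) nilpotent_poly_Unit:
  assumes T: "T \<in> carrier A" and nil: "T [^] (n::nat) = \<zero>" and c: "c 0 = 1"
  shows "(\<Oplus>l\<in>{0..<Suc m}. c l \<odot> T [^] l) \<in> Units A"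
proof -
  define P where "P = (\<Oplus>l\<in>{0..<m}. (- c (Suc l)) \<odot> T [^] l)"
  have Pc: "P \<in> carrier A" unfolding P_def using T by (intro finsum_closed) (auto simp: smult_closed)
  have eq: "(\<Oplus>l\<in>{0..<Suc m}. c l \<odot> T [^] l) = \<one> \<ominus> T \<otimes> (\<Oplus>l\<in>{0..<m}. (- c (Suc l)) \<odot> T [^] l)"
    and comm: "T \<otimes> (\<Oplus>l\<in>{0..<m}. (- c (Suc l)) \<odot> T [^] l) = (\<Oplus>l\<in>{0..<m}. (- c (Suc l)) \<odot> T [^] l) \<otimes> T"
  proof (induction m)
    case 0
    { case 1 show ?case using T c by (simp add: smult_one minus_eq) }
    { case 2 show ?case using T by simp }
  next
    case (Suc m)
    let ?P = "\<lambda>m. \<Oplus>l\<in>{0..<m}. (- c (Suc l)) \<odot> T [^] l"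
    have P: "?P m \<in> carrier A" for m using T by (intro finsum_closed) (auto simp: smult_closed)
    have PS: "?P (Suc m) = (- c (Suc m)) \<odot> T [^] m \<oplus> ?P m"
      by (subst (1) atLeast0_lessThan_Suc) (use T in \<open>simp add: Pi_iff smult_closed\<close>)
    have neg: "(- d) \<odot> y = \<ominus> (d \<odot> y)" if "y \<in> carrier A" for d y
    proof -
      have "(- d) \<odot> y \<oplus> d \<odot> y = \<zero>" using that by (simp add: smult_l_distr[symmetric] zero_sm)
      then show ?thesis using that by (simp add: minus_equality smult_closed)
    qed
    { case 1
      have "(\<Oplus>l\<in>{0..<Suc (Suc m)}. c l \<odot> T [^] l)
          = c (Suc m) \<odot> T [^] Suc m \<oplus> (\<Oplus>l\<in>{0..<Suc m}. c l \<odot> T [^] l)"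
        by (subst (1) atLeast0_lessThan_Suc) (use T in \<open>simp add: Pi_iff smult_closed\<close>)
      also have "\<dots> = \<one> \<ominus> (T \<otimes> ((- c (Suc m)) \<odot> T [^] m) \<oplus> T \<otimes> ?P m)"
        unfolding Suc(1) using T P
        by (simp add: minus_eq minus_add neg smult_mult_r r_minus smult_closed a_ac
            nat_pow_Suc2[symmetric] del: nat_pow_Suc)
      finally show ?case unfolding PS using T P by (simp add: r_distr smult_closed) }
    { case 2
      show ?case unfolding PS using T P Suc(2)
        by (simp add: r_distr l_distr smult_closed smult_mult_l smult_mult_r nat_pow_Suc2[symmetric]) }
  qed
  have "(T \<otimes> P) [^] n = T [^] n \<otimes> P [^] n"
    by (rule pow_mult_distrib[OF comm[folded P_def] T Pc])
  then have "(T \<otimes> P) [^] n = \<zero>" using nil Pc by simp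
  then show ?thesis unfolding eq P_def[symmetric] using T Pc by (simp add: one_minus_nilpotent_Unit)
qed

locale uq_pairing = uq_elements A q K Ki E F + P: algebra_pairing A A C f
  for A :: "(complex, 'a) module" (structure) and q K Ki E F
    and C :: "(complex, 'c) module" and f
begin

abbreviation "coprod_E \<equiv> f E K \<oplus>\<^bsub>C\<^esub> f \<one> E"
abbreviation "coprod_F \<equiv> f F \<one> \<oplus>\<^bsub>C\<^esub> f Ki F"

text \<open>
  The coproduct respects the relations. In \<open>\<Delta>(E) \<Delta>(F)\<close> the mixed term \<open>E Ki \<otimes> K F\<close> equals
  \<open>Ki E \<otimes> F K\<close>, since the powers of \<open>q\<close> cancel, and the two summands \<open>Ki \<otimes> K\<close> of the
  remaining brackets cancel.
\<close>

lemma coproduct_elements: "uq_elements C q (f K K) (f Ki Ki) coprod_E coprod_F"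
proof -
  let ?u = "1 / (q - inverse q)"
  note ac = P.C.a_ac P.C.smult_closed P.C.smult_r_distr
  note bil = P.add_left P.add_right P.smult_left P.smult_right smult_closed
  show ?thesis
  proof (unfold_locales, goal_cases)
    case 1 show ?case by (rule q0)
  next case 2 show ?case by (rule q2)
  next case 7 show ?case by (simp add: P.mult K_Ki P.one)
  next case 8 show ?case by (simp add: P.mult Ki_K P.one)
  next case 9 show ?case
      by (simp add: P.mult P.C.l_distr P.C.r_distr bil K_E ac)
  next case 10 show ?case
      by (simp add: P.mult P.C.l_distr P.C.r_distr bil K_F K_Ki Ki_K ac del: power_int_minus)
  next case 11
    have x: "f (E \<otimes> Ki) (K \<otimes> F) = f (Ki \<otimes> E) (F \<otimes> K)"
      unfolding K_F Ki_E by (simp add: bil)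
    have "coprod_E \<otimes>\<^bsub>C\<^esub> coprod_F
        = f (E \<otimes> F) K \<oplus>\<^bsub>C\<^esub> f F E \<oplus>\<^bsub>C\<^esub> f (E \<otimes> Ki) (K \<otimes> F) \<oplus>\<^bsub>C\<^esub> f Ki (E \<otimes> F)"
      by (simp add: P.mult P.C.l_distr P.C.r_distr ac)
    also have "\<dots> = f (F \<otimes> E) K \<oplus>\<^bsub>C\<^esub> f F E \<oplus>\<^bsub>C\<^esub> f (Ki \<otimes> E) (F \<otimes> K) \<oplus>\<^bsub>C\<^esub> f Ki (F \<otimes> E)
       \<oplus>\<^bsub>C\<^esub> (?u \<odot>\<^bsub>C\<^esub> f K K \<oplus>\<^bsub>C\<^esub> (?u \<odot>\<^bsub>C\<^esub> f Ki K \<oplus>\<^bsub>C\<^esub> (- ?u) \<odot>\<^bsub>C\<^esub> f Ki K)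
       \<oplus>\<^bsub>C\<^esub> (- ?u) \<odot>\<^bsub>C\<^esub> f Ki Ki)"
      unfolding x E_F by (simp add: bil ac)
    also have "?u \<odot>\<^bsub>C\<^esub> f Ki K \<oplus>\<^bsub>C\<^esub> (- ?u) \<odot>\<^bsub>C\<^esub> f Ki K = \<zero>\<^bsub>C\<^esub>"
      by (simp add: P.C.smult_l_distr[symmetric] P.C.zero_sm)
    finally show ?case
      by (simp add: P.mult P.C.l_distr P.C.r_distr ac)
  qed simp_all
qed

definition quasi_R :: "(nat \<Rightarrow> complex) \<Rightarrow> nat \<Rightarrow> 'c" where
  "quasi_R c n = (\<Oplus>\<^bsub>C\<^esub> l \<in> {0..<n}. c l \<odot>\<^bsub>C\<^esub> f (E [^] l) (F [^] l))"

lemma quasi_R_closed [simp]: "quasi_R c n \<in> carrier C"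
  unfolding quasi_R_def by (intro P.C.finsum_closed) (auto simp: P.C.smult_closed)

lemma quasi_R_0: "quasi_R c 0 = \<zero>\<^bsub>C\<^esub>" by (simp add: quasi_R_def)

lemma quasi_R_Suc: "quasi_R c (Suc n) = quasi_R c n \<oplus>\<^bsub>C\<^esub> c n \<odot>\<^bsub>C\<^esub> f (E [^] n) (F [^] n)"
  unfolding quasi_R_def
  by (subst atLeast0_lessThan_Suc) (simp add: Pi_iff P.C.smult_closed P.C.a_comm)

lemma quasi_R_K: "quasi_R c n \<otimes>\<^bsub>C\<^esub> f K K = f K K \<otimes>\<^bsub>C\<^esub> quasi_R c n"
proof (induction n)
  case 0 then show ?case by (simp add: quasi_R_0)
next
  case (Suc n)
  have "f (K \<otimes> E [^] n) (K \<otimes> F [^] n) = f (E [^] n \<otimes> K) (F [^] n \<otimes> K)"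
    unfolding commute_pow[OF in_carrier(1,3) K_E] commute_pow[OF in_carrier(1,4) K_F]
    using q0 by (simp add: P.smult_left P.smult_right smult_closed power_int_minus P.C.smult_assoc[symmetric]
      P.C.smult_one flip: power_mult_distrib)
  then show ?case unfolding quasi_R_Suc using Suc
    by (simp add: P.C.l_distr P.C.r_distr P.C.smult_mult_l P.C.smult_mult_r P.C.smult_closed P.mult)
qed

lemma mult_coprod_E:
  assumes "e \<in> carrier A" "g \<in> carrier A"
  shows "(c \<odot>\<^bsub>C\<^esub> f e g) \<otimes>\<^bsub>C\<^esub> coprod_E = c \<odot>\<^bsub>C\<^esub> f (e \<otimes> E) (g \<otimes> K) \<oplus>\<^bsub>C\<^esub> c \<odot>\<^bsub>C\<^esub> f e (g \<otimes> E)"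
    and "(f \<one> E \<oplus>\<^bsub>C\<^esub> f E Ki) \<otimes>\<^bsub>C\<^esub> (c \<odot>\<^bsub>C\<^esub> f e g)
      = c \<odot>\<^bsub>C\<^esub> f e (E \<otimes> g) \<oplus>\<^bsub>C\<^esub> c \<odot>\<^bsub>C\<^esub> f (E \<otimes> e) (Ki \<otimes> g)"
  using assms
  by (simp_all add: P.C.l_distr P.C.r_distr P.C.smult_mult_l P.C.smult_mult_r P.C.smult_closed
      P.C.smult_r_distr P.mult)

lemma mult_coprod_F:
  assumes "e \<in> carrier A" "g \<in> carrier A"
  shows "(c \<odot>\<^bsub>C\<^esub> f e g) \<otimes>\<^bsub>C\<^esub> coprod_F = c \<odot>\<^bsub>C\<^esub> f (e \<otimes> F) g \<oplus>\<^bsub>C\<^esub> c \<odot>\<^bsub>C\<^esub> f (e \<otimes> Ki) (g \<otimes> F)"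
    and "(f F \<one> \<oplus>\<^bsub>C\<^esub> f K F) \<otimes>\<^bsub>C\<^esub> (c \<odot>\<^bsub>C\<^esub> f e g)
      = c \<odot>\<^bsub>C\<^esub> f (F \<otimes> e) g \<oplus>\<^bsub>C\<^esub> c \<odot>\<^bsub>C\<^esub> f (K \<otimes> e) (F \<otimes> g)"
  using assms
  by (simp_all add: P.C.l_distr P.C.r_distr P.C.smult_mult_l P.C.smult_mult_r P.C.smult_closed
      P.C.smult_r_distr P.mult)

text \<open>
  The bracket of \<open>1 \<otimes> E\<close> with the term of index \<open>l + 1\<close> cancels the defect of the term of
  index \<open>l\<close> on \<open>E \<otimes> K\<close>; this is where the recursion of the coefficients enters. The sum
  telescopes, and only the defect of the last term survives.
\<close>

lemma quasi_R_E:
  assumes "\<And>l. l < n \<Longrightarrow> c (Suc l) * comm_coeff l = c l"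
  shows "quasi_R c (Suc n) \<otimes>\<^bsub>C\<^esub> coprod_E = (f \<one> E \<oplus>\<^bsub>C\<^esub> f E Ki) \<otimes>\<^bsub>C\<^esub> quasi_R c (Suc n)
    \<oplus>\<^bsub>C\<^esub> (c n \<odot>\<^bsub>C\<^esub> f (E [^] Suc n) (F [^] n \<otimes> K)
          \<oplus>\<^bsub>C\<^esub> (- c n) \<odot>\<^bsub>C\<^esub> f (E [^] Suc n) (Ki \<otimes> F [^] n))"
  using assms
proof (induction n)
  case 0
  have "c 0 \<odot>\<^bsub>C\<^esub> f E Ki \<oplus>\<^bsub>C\<^esub> (c 0 \<odot>\<^bsub>C\<^esub> f E K \<oplus>\<^bsub>C\<^esub> (- c 0) \<odot>\<^bsub>C\<^esub> f E Ki)
     = c 0 \<odot>\<^bsub>C\<^esub> f E K \<oplus>\<^bsub>C\<^esub> (c 0 + - c 0) \<odot>\<^bsub>C\<^esub> f E Ki"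
    by (simp only: P.C.smult_l_distr P.closed in_carrier P.C.a_ac P.C.smult_closed)
  then have "c 0 \<odot>\<^bsub>C\<^esub> f E Ki \<oplus>\<^bsub>C\<^esub> (c 0 \<odot>\<^bsub>C\<^esub> f E K \<oplus>\<^bsub>C\<^esub> (- c 0) \<odot>\<^bsub>C\<^esub> f E Ki) = c 0 \<odot>\<^bsub>C\<^esub> f E K"
    by (simp add: P.C.zero_sm P.C.smult_closed)
  then show ?case
    by (simp add: quasi_R_Suc quasi_R_0 P.C.l_distr P.C.r_distr P.C.smult_mult_l P.C.smult_mult_r
        P.C.smult_closed P.C.smult_r_distr P.mult P.C.a_assoc)
      (simp add: P.C.a_comm P.C.smult_closed)
next
  case (Suc n)
  let ?E = "E [^] Suc n" and ?F = "F [^] Suc n" and ?c = "c (Suc n)"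
  let ?X = "coprod_E" and ?Y = "f \<one> E \<oplus>\<^bsub>C\<^esub> f E Ki" and ?S = "quasi_R c (Suc n)"
  have EE: "E \<otimes> ?E = E [^] Suc (Suc n)" by (rule nat_pow_Suc2[symmetric]) simp
  have cl [simp]: "?E \<in> carrier A" "?F \<in> carrier A" by (simp_all del: nat_pow_Suc)
  \<comment> \<open>\<open>a\<close> and \<open>b\<close> form the defect of the old last term, \<open>r\<close> and \<open>s\<close> that of the new one, and
    \<open>p\<close> is common to both sides.\<close>
  define a where "a = f ?E (F [^] n \<otimes> K)"
  define b where "b = f ?E (Ki \<otimes> F [^] n)"
  define p where "p = f ?E (?F \<otimes> E)"
  define r where "r = f (E [^] Suc (Suc n)) (?F \<otimes> K)"
  define s where "s = f (E [^] Suc (Suc n)) (Ki \<otimes> ?F)"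
  have abc [simp]: "a \<in> carrier C" "b \<in> carrier C" "p \<in> carrier C" "r \<in> carrier C" "s \<in> carrier C"
    by (simp_all add: a_def b_def p_def r_def s_def)
  have tX: "(?c \<odot>\<^bsub>C\<^esub> f ?E ?F) \<otimes>\<^bsub>C\<^esub> ?X = ?c \<odot>\<^bsub>C\<^esub> r \<oplus>\<^bsub>C\<^esub> ?c \<odot>\<^bsub>C\<^esub> p"
    unfolding mult_coprod_E(1)[OF cl] r_def p_def by (simp only: nat_pow_Suc)
  have cn: "?c * comm_coeff n = c n" using Suc.prems[of n] by simp
  have "f ?E (E \<otimes> ?F) = p \<oplus>\<^bsub>C\<^esub> (comm_coeff n \<odot>\<^bsub>C\<^esub> a \<oplus>\<^bsub>C\<^esub> (- comm_coeff n) \<odot>\<^bsub>C\<^esub> b)"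
    unfolding E_F_pow by (simp add: P.add_right P.smult_right smult_closed a_def b_def p_def)
  then have Yt: "?Y \<otimes>\<^bsub>C\<^esub> (?c \<odot>\<^bsub>C\<^esub> f ?E ?F)
      = ?c \<odot>\<^bsub>C\<^esub> p \<oplus>\<^bsub>C\<^esub> (c n \<odot>\<^bsub>C\<^esub> a \<oplus>\<^bsub>C\<^esub> (- c n) \<odot>\<^bsub>C\<^esub> b) \<oplus>\<^bsub>C\<^esub> ?c \<odot>\<^bsub>C\<^esub> s"
    unfolding mult_coprod_E(2)[OF cl] EE s_def[symmetric]
    by (simp add: P.C.smult_closed P.C.smult_r_distr P.C.smult_assoc[symmetric] cn)
  have "quasi_R c (Suc (Suc n)) \<otimes>\<^bsub>C\<^esub> ?X = ?S \<otimes>\<^bsub>C\<^esub> ?X \<oplus>\<^bsub>C\<^esub> (?c \<odot>\<^bsub>C\<^esub> r \<oplus>\<^bsub>C\<^esub> ?c \<odot>\<^bsub>C\<^esub> p)"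
    unfolding quasi_R_Suc[of c "Suc n"] tX[symmetric]
    by (rule P.C.l_distr) (simp_all add: P.C.smult_closed)
  also have "?S \<otimes>\<^bsub>C\<^esub> ?X = ?Y \<otimes>\<^bsub>C\<^esub> ?S \<oplus>\<^bsub>C\<^esub> (c n \<odot>\<^bsub>C\<^esub> a \<oplus>\<^bsub>C\<^esub> (- c n) \<odot>\<^bsub>C\<^esub> b)"
    unfolding a_def b_def using Suc.prems by (intro Suc.IH) simp
  also have "?Y \<otimes>\<^bsub>C\<^esub> ?S \<oplus>\<^bsub>C\<^esub> (c n \<odot>\<^bsub>C\<^esub> a \<oplus>\<^bsub>C\<^esub> (- c n) \<odot>\<^bsub>C\<^esub> b) \<oplus>\<^bsub>C\<^esub> (?c \<odot>\<^bsub>C\<^esub> r \<oplus>\<^bsub>C\<^esub> ?c \<odot>\<^bsub>C\<^esub> p)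
     = ?Y \<otimes>\<^bsub>C\<^esub> ?S \<oplus>\<^bsub>C\<^esub> (?c \<odot>\<^bsub>C\<^esub> p \<oplus>\<^bsub>C\<^esub> (c n \<odot>\<^bsub>C\<^esub> a \<oplus>\<^bsub>C\<^esub> (- c n) \<odot>\<^bsub>C\<^esub> b) \<oplus>\<^bsub>C\<^esub> (?c + - ?c) \<odot>\<^bsub>C\<^esub> s)
       \<oplus>\<^bsub>C\<^esub> ?c \<odot>\<^bsub>C\<^esub> r"
    by (simp add: P.C.a_ac P.C.smult_closed P.C.zero_sm)
  also have "\<dots> = ?Y \<otimes>\<^bsub>C\<^esub> ?S \<oplus>\<^bsub>C\<^esub> ?Y \<otimes>\<^bsub>C\<^esub> (?c \<odot>\<^bsub>C\<^esub> f ?E ?F) \<oplus>\<^bsub>C\<^esub> (?c \<odot>\<^bsub>C\<^esub> r \<oplus>\<^bsub>C\<^esub> (- ?c) \<odot>\<^bsub>C\<^esub> s)"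
    unfolding Yt P.C.smult_l_distr[OF abc(5)] by (simp add: P.C.a_ac P.C.smult_closed)
  also have "?Y \<otimes>\<^bsub>C\<^esub> ?S \<oplus>\<^bsub>C\<^esub> ?Y \<otimes>\<^bsub>C\<^esub> (?c \<odot>\<^bsub>C\<^esub> f ?E ?F) = ?Y \<otimes>\<^bsub>C\<^esub> quasi_R c (Suc (Suc n))"
    unfolding quasi_R_Suc[of c "Suc n"] by (rule P.C.r_distr[symmetric]) (simp_all add: P.C.smult_closed)
  finally show ?case unfolding r_def s_def .
qed

text \<open>
  The same telescoping with the two factors exchanged: the bracket of \<open>E\<^sup>l\<^sup>+\<^sup>1\<close> with \<open>F\<close> in the
  first factor cancels the defect of the term of index \<open>l\<close> on \<open>Ki \<otimes> F\<close>.
\<close>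

lemma quasi_R_F:
  assumes "\<And>l. l < n \<Longrightarrow> c (Suc l) * comm_coeff l = c l"
  shows "quasi_R c (Suc n) \<otimes>\<^bsub>C\<^esub> coprod_F = (f F \<one> \<oplus>\<^bsub>C\<^esub> f K F) \<otimes>\<^bsub>C\<^esub> quasi_R c (Suc n)
    \<oplus>\<^bsub>C\<^esub> (c n \<odot>\<^bsub>C\<^esub> f (E [^] n \<otimes> Ki) (F [^] Suc n)
          \<oplus>\<^bsub>C\<^esub> (- c n) \<odot>\<^bsub>C\<^esub> f (K \<otimes> E [^] n) (F [^] Suc n))"
  using assms
proof (induction n)
  case 0
  have "c 0 \<odot>\<^bsub>C\<^esub> f K F \<oplus>\<^bsub>C\<^esub> (c 0 \<odot>\<^bsub>C\<^esub> f Ki F \<oplus>\<^bsub>C\<^esub> (- c 0) \<odot>\<^bsub>C\<^esub> f K F)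
     = c 0 \<odot>\<^bsub>C\<^esub> f Ki F \<oplus>\<^bsub>C\<^esub> (c 0 + - c 0) \<odot>\<^bsub>C\<^esub> f K F"
    by (simp only: P.C.smult_l_distr P.closed in_carrier P.C.a_ac P.C.smult_closed)
  then have "c 0 \<odot>\<^bsub>C\<^esub> f K F \<oplus>\<^bsub>C\<^esub> (c 0 \<odot>\<^bsub>C\<^esub> f Ki F \<oplus>\<^bsub>C\<^esub> (- c 0) \<odot>\<^bsub>C\<^esub> f K F) = c 0 \<odot>\<^bsub>C\<^esub> f Ki F"
    by (simp add: P.C.zero_sm P.C.smult_closed)
  then show ?case
    by (simp add: quasi_R_Suc quasi_R_0 P.C.l_distr P.C.r_distr P.C.smult_mult_l P.C.smult_mult_r
        P.C.smult_closed P.C.smult_r_distr P.mult P.C.a_assoc)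
next
  case (Suc n)
  let ?E = "E [^] Suc n" and ?F = "F [^] Suc n" and ?c = "c (Suc n)"
  let ?X = "coprod_F" and ?Y = "f F \<one> \<oplus>\<^bsub>C\<^esub> f K F" and ?S = "quasi_R c (Suc n)"
  have FF: "F \<otimes> ?F = F [^] Suc (Suc n)" by (rule nat_pow_Suc2[symmetric]) simp
  have cl [simp]: "?E \<in> carrier A" "?F \<in> carrier A" by (simp_all del: nat_pow_Suc)
  \<comment> \<open>\<open>a\<close> and \<open>b\<close> form the defect of the old last term, \<open>r\<close> and \<open>s\<close> that of the new one, and
    \<open>p'\<close> is common to both sides.\<close>
  define a where "a = f (E [^] n \<otimes> Ki) ?F"
  define b where "b = f (K \<otimes> E [^] n) ?F"
  define p where "p = f (?E \<otimes> F) ?F"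
  define r where "r = f (?E \<otimes> Ki) (F [^] Suc (Suc n))"
  define s where "s = f (K \<otimes> ?E) (F [^] Suc (Suc n))"
  define p' where "p' = f (F \<otimes> ?E) ?F"
  have abc [simp]: "a \<in> carrier C" "b \<in> carrier C" "p \<in> carrier C" "r \<in> carrier C" "s \<in> carrier C" "p' \<in> carrier C"
    by (simp_all add: a_def b_def p_def r_def s_def p'_def)
  have cn: "?c * comm_coeff n = c n" using Suc.prems[of n] by simp
  have "p = p' \<oplus>\<^bsub>C\<^esub> (comm_coeff n \<odot>\<^bsub>C\<^esub> b \<oplus>\<^bsub>C\<^esub> (- comm_coeff n) \<odot>\<^bsub>C\<^esub> a)"
    unfolding p_def p'_def E_pow_F by (simp add: P.add_left P.smult_left smult_closed a_def b_def)
  then have tX: "(?c \<odot>\<^bsub>C\<^esub> f ?E ?F) \<otimes>\<^bsub>C\<^esub> ?X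
      = ?c \<odot>\<^bsub>C\<^esub> p' \<oplus>\<^bsub>C\<^esub> (c n \<odot>\<^bsub>C\<^esub> b \<oplus>\<^bsub>C\<^esub> (- c n) \<odot>\<^bsub>C\<^esub> a) \<oplus>\<^bsub>C\<^esub> ?c \<odot>\<^bsub>C\<^esub> r"
    unfolding mult_coprod_F(1)[OF cl] p_def[symmetric] nat_pow_Suc[of F "Suc n", symmetric] r_def[symmetric]
    by (simp add: P.C.smult_closed P.C.smult_r_distr P.C.smult_assoc[symmetric] cn)
  have Yt: "?Y \<otimes>\<^bsub>C\<^esub> (?c \<odot>\<^bsub>C\<^esub> f ?E ?F) = ?c \<odot>\<^bsub>C\<^esub> p' \<oplus>\<^bsub>C\<^esub> ?c \<odot>\<^bsub>C\<^esub> s"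
    unfolding mult_coprod_F(2)[OF cl] FF s_def p'_def ..
  have "quasi_R c (Suc (Suc n)) \<otimes>\<^bsub>C\<^esub> ?X = ?S \<otimes>\<^bsub>C\<^esub> ?X
      \<oplus>\<^bsub>C\<^esub> (?c \<odot>\<^bsub>C\<^esub> p' \<oplus>\<^bsub>C\<^esub> (c n \<odot>\<^bsub>C\<^esub> b \<oplus>\<^bsub>C\<^esub> (- c n) \<odot>\<^bsub>C\<^esub> a) \<oplus>\<^bsub>C\<^esub> ?c \<odot>\<^bsub>C\<^esub> r)"
    unfolding quasi_R_Suc[of c "Suc n"] tX[symmetric]
    by (rule P.C.l_distr) (simp_all add: P.C.smult_closed)
  also have "?S \<otimes>\<^bsub>C\<^esub> ?X = ?Y \<otimes>\<^bsub>C\<^esub> ?S \<oplus>\<^bsub>C\<^esub> (c n \<odot>\<^bsub>C\<^esub> a \<oplus>\<^bsub>C\<^esub> (- c n) \<odot>\<^bsub>C\<^esub> b)"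
    unfolding a_def b_def using Suc.prems by (intro Suc.IH) simp
  also have "?Y \<otimes>\<^bsub>C\<^esub> ?S \<oplus>\<^bsub>C\<^esub> (c n \<odot>\<^bsub>C\<^esub> a \<oplus>\<^bsub>C\<^esub> (- c n) \<odot>\<^bsub>C\<^esub> b)
      \<oplus>\<^bsub>C\<^esub> (?c \<odot>\<^bsub>C\<^esub> p' \<oplus>\<^bsub>C\<^esub> (c n \<odot>\<^bsub>C\<^esub> b \<oplus>\<^bsub>C\<^esub> (- c n) \<odot>\<^bsub>C\<^esub> a) \<oplus>\<^bsub>C\<^esub> ?c \<odot>\<^bsub>C\<^esub> r)
     = ?Y \<otimes>\<^bsub>C\<^esub> ?S \<oplus>\<^bsub>C\<^esub> (?c \<odot>\<^bsub>C\<^esub> p' \<oplus>\<^bsub>C\<^esub> (c n + - c n) \<odot>\<^bsub>C\<^esub> a \<oplus>\<^bsub>C\<^esub> (c n + - c n) \<odot>\<^bsub>C\<^esub> b \<oplus>\<^bsub>C\<^esub> ?c \<odot>\<^bsub>C\<^esub> r)"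
    unfolding P.C.smult_l_distr[OF abc(1)] P.C.smult_l_distr[OF abc(2)]
    by (simp add: P.C.a_ac P.C.smult_closed)
  also have "\<dots> = ?Y \<otimes>\<^bsub>C\<^esub> ?S \<oplus>\<^bsub>C\<^esub> (?c \<odot>\<^bsub>C\<^esub> p' \<oplus>\<^bsub>C\<^esub> (?c + - ?c) \<odot>\<^bsub>C\<^esub> s \<oplus>\<^bsub>C\<^esub> ?c \<odot>\<^bsub>C\<^esub> r)"
    by (simp add: P.C.smult_closed P.C.zero_sm)
  also have "\<dots> = ?Y \<otimes>\<^bsub>C\<^esub> ?S \<oplus>\<^bsub>C\<^esub> ?Y \<otimes>\<^bsub>C\<^esub> (?c \<odot>\<^bsub>C\<^esub> f ?E ?F) \<oplus>\<^bsub>C\<^esub> (?c \<odot>\<^bsub>C\<^esub> r \<oplus>\<^bsub>C\<^esub> (- ?c) \<odot>\<^bsub>C\<^esub> s)"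
    unfolding Yt P.C.smult_l_distr[OF abc(5)] by (simp add: P.C.a_ac P.C.smult_closed)
  also have "?Y \<otimes>\<^bsub>C\<^esub> ?S \<oplus>\<^bsub>C\<^esub> ?Y \<otimes>\<^bsub>C\<^esub> (?c \<odot>\<^bsub>C\<^esub> f ?E ?F) = ?Y \<otimes>\<^bsub>C\<^esub> quasi_R c (Suc (Suc n))"
    unfolding quasi_R_Suc[of c "Suc n"] by (rule P.C.r_distr[symmetric]) (simp_all add: P.C.smult_closed)
  finally show ?case unfolding r_def s_def .
qed

lemma zero_right: "x \<in> carrier A \<Longrightarrow> f x \<zero> = \<zero>\<^bsub>C\<^esub>"
  using P.smult_right[of x \<zero> 0] by (simp add: smult_zero P.C.zero_sm)

text \<open>
  For generic \<open>q\<close> the sum is infinite and nothing is left over. Here the defect of the last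
  term has to vanish. For \<open>F\<close> it does because \<open>F\<^sup>n\<^sup>+\<^sup>1 = 0\<close>. For \<open>E\<close> the defect contains \<open>E\<^sup>n\<^sup>+\<^sup>1\<close>, which in the
  semicyclic representations is the nonzero scalar \<open>a\<close>; it is the relation between \<open>F\<^sup>n\<close> and \<open>K\<close>
  that makes the other factor vanish.
\<close>

lemma quasi_R_intertwines:
  assumes c: "\<And>l. l < n \<Longrightarrow> c (Suc l) * comm_coeff l = c l"
    and nil: "F [^] Suc n = \<zero>" and top: "F [^] n \<otimes> K = Ki \<otimes> F [^] n"
  shows "quasi_R c (Suc n) \<otimes>\<^bsub>C\<^esub> coprod_E = (f \<one> E \<oplus>\<^bsub>C\<^esub> f E Ki) \<otimes>\<^bsub>C\<^esub> quasi_R c (Suc n)"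
    and "quasi_R c (Suc n) \<otimes>\<^bsub>C\<^esub> coprod_F = (f F \<one> \<oplus>\<^bsub>C\<^esub> f K F) \<otimes>\<^bsub>C\<^esub> quasi_R c (Suc n)"
proof -
  have cancel: "c n \<odot>\<^bsub>C\<^esub> x \<oplus>\<^bsub>C\<^esub> (- c n) \<odot>\<^bsub>C\<^esub> x = \<zero>\<^bsub>C\<^esub>" if "x \<in> carrier C" for x
    using that by (simp add: P.C.smult_l_distr[symmetric] P.C.zero_sm)
  show "quasi_R c (Suc n) \<otimes>\<^bsub>C\<^esub> coprod_E = (f \<one> E \<oplus>\<^bsub>C\<^esub> f E Ki) \<otimes>\<^bsub>C\<^esub> quasi_R c (Suc n)"
    using quasi_R_E[of n c, OF c] by (simp add: top cancel)
  show "quasi_R c (Suc n) \<otimes>\<^bsub>C\<^esub> coprod_F = (f F \<one> \<oplus>\<^bsub>C\<^esub> f K F) \<otimes>\<^bsub>C\<^esub> quasi_R c (Suc n)"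
    using quasi_R_F[of n c, OF c, unfolded nil] by (simp add: zero_right P.C.smult_zero)
qed

text \<open>
  The terms are multiples of the powers of \<open>E \<otimes> F\<close>, which is nilpotent since \<open>F\<close> is.
\<close>

lemma quasi_R_Unit:
  assumes nil: "F [^] Suc n = \<zero>" and c: "c 0 = 1"
  shows "quasi_R c (Suc n) \<in> Units C"
proof -
  have pow: "f (E [^] l) (F [^] l) = f E F [^]\<^bsub>C\<^esub> l" for l :: nat
    by (induction l) (simp_all add: P.one P.mult[symmetric])
  have "f E F [^]\<^bsub>C\<^esub> Suc n = \<zero>\<^bsub>C\<^esub>"
    unfolding pow[symmetric] nil by (simp add: zero_right)
  from P.C.nilpotent_poly_Unit[of _ _ c n, OF _ this c] show ?thesis
    unfolding quasi_R_def pow by simp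
qed

end

section \<open>Kronecker products\<close>

lemma sum_div_mod:
  fixes g :: "nat \<Rightarrow> nat \<Rightarrow> 'a :: comm_monoid_add"
  shows "(\<Sum>k<n * m. g (k div m) (k mod m)) = (\<Sum>x<n. \<Sum>y<m. g x y)"
proof -
  have "(\<Sum>x<n. \<Sum>y<m. g x y) = (\<Sum>x<n. \<Sum>k = x * m..<x * m + m. g (k div m) (k mod m))"
  proof (rule sum.cong[OF refl])
    fix x
    show "(\<Sum>y<m. g x y) = (\<Sum>k = x * m..<x * m + m. g (k div m) (k mod m))"
      by (rule sum.reindex_bij_witness[of _ "\<lambda>k. k - x * m" "\<lambda>y. x * m + y"])
        (auto simp: div_add1_eq)
  qed
  then show ?thesis by (simp add: sum.nat_group)
qed

lemma kron_dim [simp]: "A \<in> carrier_mat n n \<Longrightarrow> B \<in> carrier_mat m m \<Longrightarrow> kron A B \<in> carrier_mat (n * m) (n * m)"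
  by (simp add: kron_def)

lemma kron_index:
  assumes "A \<in> carrier_mat n n" "B \<in> carrier_mat m m" "r < n * m" "c < n * m"
  shows "kron A B $$ (r, c) = A $$ (r div m, c div m) * B $$ (r mod m, c mod m)"
  using assms by (simp add: kron_def)

lemma div_mod_less:
  fixes c :: nat assumes "c < n * m" shows "c div m < n" "c mod m < m"
  using assms by (cases "m = 0"; simp add: less_mult_imp_div_less)+

lemma mat_mult_index:
  assumes "A \<in> carrier_mat n n" "B \<in> carrier_mat n n" "r < n" "c < n"
  shows "(A * B) $$ (r, c) = (\<Sum>k<n. A $$ (r, k) * B $$ (k, c))"
  using assms by (auto simp: scalar_prod_def atLeast0LessThan)

lemma kron_mult:
  assumes A: "A \<in> carrier_mat n n" "A' \<in> carrier_mat n n"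
    and B: "B \<in> carrier_mat m m" "B' \<in> carrier_mat m m"
  shows "kron A B * kron A' B' = kron (A * A') (B * B')"
proof (rule eq_matI)
  have c: "kron A B * kron A' B' \<in> carrier_mat (n * m) (n * m)"
    "kron (A * A') (B * B') \<in> carrier_mat (n * m) (n * m)" using assms by (auto intro!: mult_carrier_mat[of _ _ "n * m"])
  then show "dim_row (kron A B * kron A' B') = dim_row (kron (A * A') (B * B'))"
    "dim_col (kron A B * kron A' B') = dim_col (kron (A * A') (B * B'))" by auto
  fix r s assume "r < dim_row (kron (A * A') (B * B'))" "s < dim_col (kron (A * A') (B * B'))"
  then have rs: "r < n * m" "s < n * m" using c by auto
  note dm = div_mod_less[OF rs(1)] div_mod_less[OF rs(2)]
  have "(kron A B * kron A' B') $$ (r, s) = (\<Sum>k<n * m. kron A B $$ (r, k) * kron A' B' $$ (k, s))"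
    using assms rs by (intro mat_mult_index) auto
  also have "\<dots> = (\<Sum>k<n * m. (A $$ (r div m, k div m) * A' $$ (k div m, s div m)) *
      (B $$ (r mod m, k mod m) * B' $$ (k mod m, s mod m)))"
    using assms rs by (intro sum.cong refl) (simp add: kron_index[of _ n _ m])
  also have "\<dots> = (\<Sum>x<n. \<Sum>y<m. (A $$ (r div m, x) * A' $$ (x, s div m)) *
      (B $$ (r mod m, y) * B' $$ (y, s mod m)))"
    by (rule sum_div_mod)
  also have "\<dots> = (\<Sum>x<n. A $$ (r div m, x) * A' $$ (x, s div m)) * (\<Sum>y<m. B $$ (r mod m, y) * B' $$ (y, s mod m))"
    unfolding sum_product ..
  also have "\<dots> = kron (A * A') (B * B') $$ (r, s)"
    using assms rs dm mat_mult_index[OF A dm(1,3)] mat_mult_index[OF B dm(2,4)]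
    by (simp add: kron_index[of _ n _ m])
  finally show "(kron A B * kron A' B') $$ (r, s) = kron (A * A') (B * B') $$ (r, s)" .
qed

lemma kron_pairing: "algebra_pairing (mat_algebra n) (mat_algebra m) (mat_algebra (n * m)) kron"
proof -
  interpret A: complex_algebra "mat_algebra n" by (rule mat_alg)
  interpret B: complex_algebra "mat_algebra m" by (rule mat_alg)
  interpret C: complex_algebra "mat_algebra (n * m)" by (rule mat_alg)
  show ?thesis
  proof (unfold_locales, unfold module_mat_simps, goal_cases)
    case (1 x y) then show ?case by simp
  next case (2 x y x' y') then show ?case by (intro kron_mult)
  next case 3
    show ?case
    proof (rule eq_matI)
      fix r c assume "r < dim_row (1\<^sub>m (n * m) :: complex mat)" "c < dim_col (1\<^sub>m (n * m) :: complex mat)"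
      then have rc: "r < n * m" "c < n * m" by auto
      have "r = c" if "r div m = c div m" "r mod m = c mod m" using that by (metis div_mult_mod_eq)
      then show "kron (1\<^sub>m n) (1\<^sub>m m) $$ (r, c) = 1\<^sub>m (n * m) $$ (r, c)"
        using rc div_mod_less[OF rc(1)] div_mod_less[OF rc(2)]
        by (auto simp: kron_index[of _ n _ m])
    qed (simp_all add: kron_def)
  next case (4 x y x') then show ?case 
      by (intro eq_matI) (auto simp: kron_def algebra_simps div_mod_less)
  next case (5 x y y') then show ?case 
      by (intro eq_matI) (auto simp: kron_def algebra_simps div_mod_less)
  next case (6 x y c) then show ?case 
      by (intro eq_matI) (auto simp: kron_def algebra_simps div_mod_less)
  next case (7 x y c) then show ?case 
      by (intro eq_matI) (auto simp: kron_def algebra_simps div_mod_less)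
  qed
qed

section \<open>The semicyclic representations\<close>

locale semicyclic_setting =
  fixes N i :: nat and a :: complex
  assumes N3: "3 \<le> N" and oddN: "odd N" and a0: "a \<noteq> 0" and iN: "i < N"
begin

abbreviation "q \<equiv> qroot N"
abbreviation "w \<equiv> weight N i"

lemma q_eq_cis: "q = cis (pi / N)"
  by (simp add: qroot_def cis_conv_exp mult.commute)

lemma q_power: "q ^ n = cis (n * pi / N)"
  unfolding q_eq_cis by (simp add: DeMoivre)

lemma q_nonzero: "q \<noteq> 0" by (simp add: q_eq_cis)

lemma q_power_N: "q ^ N = -1" using N3 by (simp add: q_power)

lemma q_power_eq_pm1:
  assumes "q ^ n = 1 \<or> q ^ n = -1" shows "N dvd n"
proof -
  have "sin (n * pi / N) = 0" using assms unfolding q_power by (auto simp: complex_eq_iff)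
  then obtain m :: int where "n * pi / N = m * pi" using sin_zero_iff_int2 by blast
  then have "real n = m * N" using N3 by (simp add: field_simps)
  then have "int n = m * int N" using of_int_eq_iff[where 'a = real] by (metis of_int_mult of_int_of_nat_eq)
  then show ?thesis by (metis dvd_triv_right int_dvd_int_iff)
qed

lemma q_power_2: "q\<^sup>2 \<noteq> 1"
  using q_power_eq_pm1[of 2] N3 dvd_imp_le[of N 2] by auto

text \<open>
  Indices of basis vectors matter only modulo \<open>N\<close>, so weights are determined modulo \<open>2 N\<close>; powers
  of \<open>q\<close> do not see the difference.
\<close>

lemma q_powi_periodic: "q powi (m + 2 * int N * t) = q powi m"
proof -
  have "q powi (2 * int N * t) = (q powi (2 * int N)) powi t" by (rule power_int_mult)
  also have "q powi (2 * int N) = (q ^ N)\<^sup>2"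
    by (metis mult.commute of_nat_mult of_nat_numeral power_int_of_nat power_mult)
  finally show ?thesis using q_nonzero by (simp add: power_int_add q_power_N)
qed

lemma weight_even: "even (w k)" using oddN by (simp add: weight_def)

text \<open>
  The eigenvalues of \<open>q\<close> to the power \<open>H \<otimes> H / 2\<close>; the exponent is an integer because all weights
  are even.
\<close>

definition phase :: "nat \<Rightarrow> nat \<Rightarrow> complex" where
  "phase j k = q powi (w j * w k div 2)"

lemma phase_commute: "phase j k = phase k j" by (simp add: phase_def mult.commute)

text \<open>
  A wrap-around of the index changes the weight by a multiple of \<open>2 N\<close>, and then half the product
  with the even number \<open>w k\<close> changes by a multiple of \<open>2 N\<close> as well. This is why the diagonal factor
  still conjugates correctly when \<open>E\<close> maps the last basis vector to the first one.
\<close>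

lemma phase_shift:
  assumes "int r = (int c + s) mod int N"
  shows "phase r k = q powi (s * w k) * phase c k"
proof -
  have "int N dvd int r - (int c + s)" using assms by (simp add: mod_eq_dvd_iff[symmetric])
  then obtain t where t: "int r = int c + s + int N * t" by (metis add.commute diff_add_cancel dvdE)
  obtain v where v: "w k = 2 * v" using weight_even by blast
  have "w r = w c + 2 * s + 2 * int N * t" using t by (simp add: weight_def)
  then have "w r * w k div 2 = s * w k + w c * w k div 2 + 2 * int N * (v * t)"
    by (simp add: v algebra_simps)
  then show ?thesis using q_nonzero by (simp only: phase_def q_powi_periodic power_int_add simp_thms)
qed

lemma R_diag_eq: "R_diag N i = mat_diag (N * N) (\<lambda>c. phase (c div N) (c mod N))"
proof -
  have *: "exp (complex_of_real pi * \<i> / of_nat N * (of_int (w j * w k) / 2)) = phase j k" for j k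
  proof -
    obtain v where v: "w j = 2 * v" using weight_even by blast
    have "phase j k = exp (of_int (v * w k) * (complex_of_real pi * \<i> / of_nat N))"
      unfolding phase_def v qroot_def by (simp add: exp_power_int mult.commute)
    then show ?thesis by (simp add: v mult_ac)
  qed
  show ?thesis unfolding R_diag_def mat_diag_def * ..
qed

lemma R_diag_kron:
  assumes c: "X \<in> carrier_mat N N" "Y \<in> carrier_mat N N" "X' \<in> carrier_mat N N" "Y' \<in> carrier_mat N N"
    and eq: "\<And>r s r' s'. r < N \<Longrightarrow> s < N \<Longrightarrow> r' < N \<Longrightarrow> s' < N \<Longrightarrow>
      phase r r' * (X $$ (r, s) * Y $$ (r', s')) = (X' $$ (r, s) * Y' $$ (r', s')) * phase s s'"
  shows "R_diag N i * kron X Y = kron X' Y' * R_diag N i"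
  using c unfolding R_diag_eq
  by (simp add: mat_diag_mult_left[of _ _ "N * N"] mat_diag_mult_right[of _ "N * N"])
    (rule eq_matI; simp add: kron_index[of _ N _ N] eq div_mod_less)

lemma R_diag_Unit: "R_diag N i \<in> Units (mat_algebra (N * N))"
proof -
  have "phase j k \<noteq> 0" for j k using q_nonzero by (simp add: phase_def)
  then have "R_diag N i * mat_diag (N * N) (\<lambda>c. inverse (phase (c div N) (c mod N))) = 1\<^sub>m (N * N)"
    "mat_diag (N * N) (\<lambda>c. inverse (phase (c div N) (c mod N))) * R_diag N i = 1\<^sub>m (N * N)"
    by (simp_all add: R_diag_eq)
  then show ?thesis unfolding Units_def module_mat_simps
    by (auto simp: R_diag_eq intro!: bexI[of _ "mat_diag (N * N) (\<lambda>c. inverse (phase (c div N) (c mod N)))"])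
qed

abbreviation "KK \<equiv> semicyclic_gen N a i GenK"
abbreviation "KI \<equiv> semicyclic_gen N a i GenKinv"
abbreviation "EE \<equiv> semicyclic_gen N a i GenE"
abbreviation "FF \<equiv> semicyclic_gen N a i GenF"

lemma gen_carrier [simp]: "semicyclic_gen N a i g \<in> carrier_mat N N"
  by (simp add: semicyclic_gen_def)

lemma KK_eq: "KK = mat_diag N (\<lambda>c. q powi w c)"
  and KI_eq: "KI = mat_diag N (\<lambda>c. q powi (- w c))"
  by (auto simp: semicyclic_gen_def mat_diag_def)

text \<open>
  Since \<open>[N - k] = [k]\<close>, the coefficient \<open>[k] [N - k]\<close> of \<open>F\<close> is \<open>[k]\<^sup>2\<close>. This square has period
  \<open>N\<close> in \<open>k\<close>, so the remainder modulo \<open>N\<close> in the definition of the representation can be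
  dropped.
\<close>

definition F_coeff :: "nat \<Rightarrow> complex" where
  "F_coeff c = (qint q (int c - int i))\<^sup>2"

lemma qint_reflect: "qint q (int N - m) = qint q m"
  and qint_shift: "qint q (m + int N) = - qint q m"
proof -
  have "q powi (int N) = -1" using q_power_N by simp
  then have "q powi (m + int N) = - (q powi m)" for m
    using q_nonzero by (simp add: power_int_add)
  from this[of m] this[of "-m"] this[of "m - int N"] this[of "- m - int N"]
  show "qint q (int N - m) = qint q m" "qint q (m + int N) = - qint q m"
    by (simp_all add: qint_def algebra_simps minus_divide_left)
qed

lemma qint_square_mod: "(qint q (m mod int N))\<^sup>2 = (qint q m)\<^sup>2"
proof -
  have *: "(qint q (m + int N * int t))\<^sup>2 = (qint q m)\<^sup>2" for m t
  proof (induction t)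
    case (Suc t)
    have "qint q (m + int N * int (Suc t)) = - qint q (m + int N * int t)"
      using qint_shift[of "m + int N * int t"] by (simp add: algebra_simps)
    then show ?case using Suc by simp
  qed simp
  have m: "m = m mod int N + int N * (m div int N)" by simp
  show ?thesis
  proof (cases "0 \<le> m div int N")
    case True
    then have "m = m mod int N + int N * int (nat (m div int N))" using m by simp
    then show ?thesis using * by metis
  next
    case False
    then have "m mod int N = m + int N * int (nat (- (m div int N)))"
      using m by (simp add: algebra_simps)
    then show ?thesis using * by metis
  qed
qed

lemma EE_index: "r < N \<Longrightarrow> c < N \<Longrightarrow>
    EE $$ (r, c) = (if r = (c + 1) mod N then (if c = N - 1 then a else 1) else 0)"
  using N3 by (auto simp: semicyclic_gen_def)

lemma pred_eq: "(int c - 1) mod int N = int ((c + (N - 1)) mod N)"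
proof -
  have "int (c + (N - 1)) = (int c - 1) + int N" using N3 by simp
  then show ?thesis by (simp only: of_nat_mod mod_add_self2)
qed

lemma FF_index: "r < N \<Longrightarrow> c < N \<Longrightarrow>
    FF $$ (r, c) = (if r = (c + (N - 1)) mod N then F_coeff c / (if c = 0 then a else 1) else 0)"
  by (auto simp: semicyclic_gen_def Let_def qint_reflect power2_eq_square[symmetric] qint_square_mod F_coeff_def pred_eq)

lemma gen_shift:
  assumes "r < N" "c < N"
  shows "EE $$ (r, c) \<noteq> 0 \<Longrightarrow> int r = (int c + 1) mod int N"
    and "FF $$ (r, c) \<noteq> 0 \<Longrightarrow> int r = (int c + - 1) mod int N"
proof -
  show "EE $$ (r, c) \<noteq> 0 \<Longrightarrow> int r = (int c + 1) mod int N"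
    using assms by (auto simp: EE_index zmod_int add.commute split: if_splits)
  show "FF $$ (r, c) \<noteq> 0 \<Longrightarrow> int r = (int c + - 1) mod int N"
    using assms pred_eq[of c] by (auto simp: FF_index split: if_splits)
qed

lemma powi_weight_shift:
  assumes "int r = (int c + s) mod int N"
  shows "q powi w r = q powi (2 * s) * q powi w c"
proof -
  have "int N dvd int r - (int c + s)" using assms by (simp add: mod_eq_dvd_iff[symmetric])
  then obtain t where t: "int r = int c + s + int N * t" by (metis add.commute diff_add_cancel dvdE)
  have "w r = 2 * s + w c + 2 * int N * t" using t by (simp add: weight_def)
  then show ?thesis using q_nonzero by (simp only: q_powi_periodic power_int_add simp_thms)
qed

lemma K_conj:
  assumes X: "X \<in> carrier_mat N N"
    and shift: "\<And>r c. r < N \<Longrightarrow> c < N \<Longrightarrow> X $$ (r, c) \<noteq> 0 \<Longrightarrow> int r = (int c + s) mod int N"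
  shows "KK * X = q powi (2 * s) \<cdot>\<^sub>m (X * KK)"
proof -
  have "q powi w r * X $$ (r, c) = q powi (2 * s) * (X $$ (r, c) * q powi w c)"
    if "r < N" "c < N" for r c
    using powi_weight_shift[OF shift[OF that]] by (cases "X $$ (r, c) = 0") auto
  then show ?thesis using X unfolding KK_eq
    by (simp add: mat_diag_mult_left mat_diag_mult_right) (rule eq_matI; simp)
qed

text \<open>
  The factors \<open>a\<close> and \<open>1 / a\<close> occur at the same step of the cycle and cancel.
\<close>

lemma EE_mult_FF: "EE * FF = mat_diag N F_coeff"
proof (rule eq_matI)
  fix r c assume "r < dim_row (mat_diag N F_coeff)" "c < dim_col (mat_diag N F_coeff)"
  then have rc: "r < N" "c < N" using mat_diag_dim[of N F_coeff] by auto
  let ?p = "(c + (N - 1)) mod N"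
  have p: "?p < N" using rc by simp
  have succ: "(?p + 1) mod N = c" using rc by (simp add: mod_simps)
  have last: "?p = N - 1 \<longleftrightarrow> c = 0"
    using rc N3 by (cases "c = 0") (auto simp: mod_if)
  have "(EE * FF) $$ (r, c) = (\<Sum>k<N. EE $$ (r, k) * FF $$ (k, c))"
    using rc by (intro mat_mult_index) simp_all
  also have "\<dots> = (\<Sum>k<N. if k = ?p then EE $$ (r, k) * (F_coeff c / (if c = 0 then a else 1)) else 0)"
    using rc by (intro sum.cong) (auto simp: FF_index)
  also have "\<dots> = EE $$ (r, ?p) * (F_coeff c / (if c = 0 then a else 1))" using p by simp
  also have "\<dots> = mat_diag N F_coeff $$ (r, c)"
    using rc p succ last a0 by (auto simp: EE_index mat_diag_def)
  finally show "(EE * FF) $$ (r, c) = mat_diag N F_coeff $$ (r, c)" .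
qed (simp_all add: mat_diag_def semicyclic_gen_def)

lemma FF_mult_EE: "FF * EE = mat_diag N (\<lambda>c. (qint q (int c - int i + 1))\<^sup>2)"
proof (rule eq_matI)
  let ?d = "\<lambda>c. (qint q (int c - int i + 1))\<^sup>2"
  fix r c assume "r < dim_row (mat_diag N ?d)" "c < dim_col (mat_diag N ?d)"
  then have rc: "r < N" "c < N" using mat_diag_dim[of N ?d] by auto
  let ?s = "(c + 1) mod N"
  have s: "?s < N" using rc by simp
  have pred: "(?s + (N - 1)) mod N = c"
  proof (cases "c = N - 1")
    case False
    then have "?s + (N - 1) = c + N" using rc by simp
    then show ?thesis using rc by simp
  qed (use N3 in simp)
  have first: "?s = 0 \<longleftrightarrow> c = N - 1" using rc N3 by (auto simp: mod_if)
  have coeff: "F_coeff ?s = ?d c"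
  proof (cases "c = N - 1")
    case True
    then have "?d c = (qint q (- int i + int N))\<^sup>2" using N3 by (simp add: of_nat_diff algebra_simps)
    then show ?thesis unfolding qint_shift using True first by (simp add: F_coeff_def)
  next
    case False
    then have "?s = c + 1" using rc by simp
    then show ?thesis by (simp add: F_coeff_def algebra_simps)
  qed
  have "(FF * EE) $$ (r, c) = (\<Sum>k<N. FF $$ (r, k) * EE $$ (k, c))"
    using rc by (intro mat_mult_index) simp_all
  also have "\<dots> = (\<Sum>k<N. if k = ?s then FF $$ (r, k) * (if c = N - 1 then a else 1) else 0)"
    using rc by (intro sum.cong) (auto simp: EE_index)
  also have "\<dots> = FF $$ (r, ?s) * (if c = N - 1 then a else 1)" using s by simp
  also have "\<dots> = mat_diag N ?d $$ (r, c)"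
    using rc s pred first a0 coeff by (auto simp: FF_index mat_diag_def)
  finally show "(FF * EE) $$ (r, c) = mat_diag N ?d $$ (r, c)" .
qed (simp_all add: mat_diag_def semicyclic_gen_def)

text \<open>
  The eigenvalue form of the relation between \<open>E\<close> and \<open>F\<close>; since \<open>q\<^sup>N = -1\<close>, the weight enters
  through \<open>q powi (1 - N + 2 m) = - q (q powi m)\<^sup>2\<close>.
\<close>

lemma qint_square_diff:
  "(qint q m)\<^sup>2 = (qint q (m + 1))\<^sup>2
     + (1 / (q - inverse q) * q powi (1 - int N + 2 * m) - 1 / (q - inverse q) * q powi (- (1 - int N + 2 * m)))"
proof -
  define x where "x = q powi m"
  define y where "y = inverse x"
  define p where "p = inverse q"
  define u where "u = 1 / (q - p)"
  have xy: "x * y = 1" and qp: "q * p = 1"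
    using q_nonzero by (simp_all add: x_def y_def p_def)
  have "q - p \<noteq> 0" using q_power_2 q_nonzero by (auto simp: p_def field_simps power2_eq_square)
  then have u: "u * (q - p) = 1" by (simp add: u_def)
  have qN: "q powi (int N) = -1" "q powi (- int N) = -1"
    using q_power_N by (simp_all add: power_int_minus)
  have "q powi (1 - int N + 2 * m) = q powi (- int N) * (q * (x * x))"
  proof -
    have "1 - int N + 2 * m = - int N + (1 + (m + m))" by simp
    then show ?thesis using q_nonzero by (simp only: x_def power_int_add power_int_1_right simp_thms)
  qed
  then have e1: "q powi (1 - int N + 2 * m) = - (q * x\<^sup>2)" by (simp add: qN power2_eq_square)
  then have e2: "q powi (- (1 - int N + 2 * m)) = - (p * y\<^sup>2)"
    unfolding power_int_minus[of q "1 - int N + 2 * m"] e1 by (simp add: p_def y_def power_inverse)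
  have i1: "qint q m = u * (x - y)"
    by (simp add: qint_def u_def p_def x_def y_def power_int_minus)
  have "q powi (m + 1) = x * q" "q powi (- (m + 1)) = y * p"
    using q_nonzero by (simp_all only: x_def y_def p_def power_int_minus[of q "m + 1"] power_int_add
      power_int_1_right inverse_mult_distrib simp_thms)
  then have i2: "qint q (m + 1) = u * (x * q - y * p)"
    by (simp only: qint_def u_def p_def times_divide_eq_left mult_1_left)
  have c1: "x * q * (y * p) = 1" using xy qp by (metis mult.assoc mult.left_commute mult_1_right)
  have "(u * (x * q - y * p))\<^sup>2 + (u * (- (q * x\<^sup>2)) - u * (- (p * y\<^sup>2)))
    = u\<^sup>2 * (x\<^sup>2 * q\<^sup>2 + y\<^sup>2 * p\<^sup>2 - 2 * (x * q * (y * p))) + u * 1 * (p * y\<^sup>2 - q * x\<^sup>2)"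
    by (simp add: power2_eq_square algebra_simps)
  also have "\<dots> = u\<^sup>2 * (x\<^sup>2 * q\<^sup>2 + y\<^sup>2 * p\<^sup>2 - 2 * (x * q * (y * p)))
      + u * (u * (q - p)) * (p * y\<^sup>2 - q * x\<^sup>2)"
    unfolding u ..
  also have "\<dots> = u\<^sup>2 * (x\<^sup>2 * (q * p) + y\<^sup>2 * (q * p) - 2 * (x * q * (y * p)))"
    by (simp add: power2_eq_square algebra_simps)
  also have "\<dots> = (u * (x - y))\<^sup>2"
    unfolding c1 qp by (simp add: power2_eq_square algebra_simps, simp add: xy mult.assoc[symmetric])
  finally show ?thesis unfolding e1 e2 i1 i2 u_def p_def ..
qed

sublocale S: uq_elements "mat_algebra N" q KK KI EE FF
proof -
  interpret complex_algebra "mat_algebra N" by (rule mat_alg)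
  show "uq_elements (mat_algebra N) q KK KI EE FF"
  proof (unfold_locales, unfold module_mat_simps, goal_cases)
    case 1 show ?case by (rule q_nonzero)
  next case 2 show ?case by (rule q_power_2)
  next case 7 show ?case using q_nonzero by (simp add: KK_eq KI_eq power_int_minus)
  next case 8 show ?case using q_nonzero by (simp add: KK_eq KI_eq power_int_minus)
  next case 9 show ?case using K_conj[of EE 1] gen_shift(1) by simp
  next case 10 show ?case using K_conj[of FF "-1"] gen_shift(2) by simp
  next case 11 
    have "F_coeff c = (qint q (int c - int i + 1))\<^sup>2 + (1 / (q - inverse q) * q powi w c - 1 / (q - inverse q) * q powi (- w c))" for c
      unfolding F_coeff_def weight_def by (rule qint_square_diff)
    then show ?case unfolding EE_mult_FF FF_mult_EE KK_eq KI_eq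
      by (intro eq_matI) (auto simp: mat_diag_def simp del: power_int_minus)
  qed simp_all
qed

lemma pow_eq: "X \<in> carrier_mat N N \<Longrightarrow> X [^]\<^bsub>mat_algebra N\<^esub> (l::nat) = X ^\<^sub>m l"
  by (induction l) (auto simp: module_mat_simps S.nat_pow_0 S.nat_pow_Suc)

text \<open>
  Going down the chain that ends at the vector of index \<open>i\<close>: the coefficient of \<open>F\<close> is zero there, so
  \<open>F\<^sup>l\<close> is nonzero only on vectors at least \<open>l\<close> steps above it.
\<close>

lemma FF_pow_index:
  assumes "r < N" "c < N" "(FF ^\<^sub>m l) $$ (r, c) \<noteq> 0"
  shows "int r = (int c - int l) mod int N \<and> int l \<le> (int c - int i) mod int N"
  using assms
proof (induction l arbitrary: c)
  case 0
  then show ?case using N3 by (auto split: if_splits simp: semicyclic_gen_def)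
next
  case (Suc l)
  have "(FF ^\<^sub>m Suc l) $$ (r, c) = (\<Sum>k<N. (FF ^\<^sub>m l) $$ (r, k) * FF $$ (k, c))"
    using Suc.prems by (simp add: mat_mult_index[of _ N])
  then obtain k where k: "k < N" "(FF ^\<^sub>m l) $$ (r, k) \<noteq> 0" "FF $$ (k, c) \<noteq> 0"
    using Suc.prems by (metis (no_types, lifting) lessThan_iff mult_eq_0_iff sum.neutral)
  have kc: "int k = (int c - 1) mod int N" using gen_shift(2)[OF k(1) Suc.prems(2) k(3)] by simp
  have IH: "int r = (int k - int l) mod int N" "int l \<le> (int k - int i) mod int N"
    using Suc.IH[OF Suc.prems(1) k(1,2)] by auto
  have r: "int r = (int c - int (Suc l)) mod int N"
    unfolding IH(1) kc by (simp add: mod_simps algebra_simps)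
  define m where "m = (int c - int i) mod int N"
  have "F_coeff c \<noteq> 0" using k Suc.prems by (auto simp: FF_index split: if_splits)
  then have "m \<noteq> 0" using qint_square_mod[of "int c - int i"] by (auto simp: F_coeff_def m_def qint_def)
  then have m: "0 < m" "m < int N"
    using N3 pos_mod_bound[of "int N" "int c - int i"] pos_mod_sign[of "int N" "int c - int i"]
    by (simp_all add: m_def order_less_le)
  have "(int k - int i) mod int N = (m - 1) mod int N"
    unfolding kc m_def by (simp add: mod_simps algebra_simps)
  also have "\<dots> = m - 1" using m by simp
  finally show ?case using r IH(2) by (simp add: m_def)
qed

lemma FF_nilpotent: "FF [^]\<^bsub>mat_algebra N\<^esub> N = 0\<^sub>m N N"
proof (rule eq_matI)
  fix r c assume "r < dim_row (0\<^sub>m N N :: complex mat)" "c < dim_col (0\<^sub>m N N :: complex mat)"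
  then have rc: "r < N" "c < N" by auto
  have "(int c - int i) mod int N < int N" using N3 by (intro pos_mod_bound) simp
  then have "\<not> int N \<le> (int c - int i) mod int N" by simp
  then have "(FF ^\<^sub>m N) $$ (r, c) = 0" using FF_pow_index[OF rc, of N] by blast
  then show "(FF [^]\<^bsub>mat_algebra N\<^esub> N) $$ (r, c) = 0\<^sub>m N N $$ (r, c)"
    using rc by (simp add: pow_eq)
qed (use N3 in \<open>simp_all add: pow_eq carrier_matD[OF gen_carrier]\<close>)

text \<open>
  By \<open>FF_pow_index\<close>, \<open>F\<^sup>N\<^sup>-\<^sup>1\<close> maps only the top vector, of index \<open>i - 1\<close>, to a multiple of the bottom
  one, of index \<open>i\<close>. Their weights are opposite modulo \<open>2 N\<close>.
\<close>

lemma FF_top: "FF [^]\<^bsub>mat_algebra N\<^esub> (N - 1) * KK = KI * FF [^]\<^bsub>mat_algebra N\<^esub> (N - 1)"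
proof -
  let ?X = "FF ^\<^sub>m (N - 1)"
  have X: "?X \<in> carrier_mat N N" by simp
  have "?X $$ (r, c) * q powi w c = q powi (- w r) * ?X $$ (r, c)" if rc: "r < N" "c < N" for r c
  proof (cases "?X $$ (r, c) = 0")
    case False
    define m where "m = (int c - int i) mod int N"
    have "int r = (int c - int (N - 1)) mod int N" "int (N - 1) \<le> m" "m < int N"
      using FF_pow_index[OF rc False] N3 by (auto simp: m_def)
    moreover have "(int c - int (N - 1)) mod int N = (int c + 1) mod int N"
      using N3 minus_mod_self2[of "int c + 1" "int N"] by (simp add: of_nat_diff algebra_simps)
    ultimately have r: "int r = (int c + 1) mod int N" and m: "m = int N - 1"
      using N3 by simp_all
    define t where "t = (int c - int i) div int N + 1"
    have "int c - int i = m + int N * ((int c - int i) div int N)" by (simp add: m_def)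
    then have t: "int c - int i = -1 + int N * t" unfolding m t_def by (simp add: algebra_simps)
    have wr: "q powi w r = q powi 2 * q powi w c" using powi_weight_shift[OF r] by simp
    then have "q powi w r * q powi w c = q powi (2 + w c + w c)"
      using q_nonzero by (simp only: wr power_int_add simp_thms)
    also have "2 + w c + w c = 0 + 2 * int N * (2 * t - 1)" using t by (simp add: weight_def algebra_simps)
    also have "q powi \<dots> = 1" unfolding q_powi_periodic by simp
    finally have "q powi w c = q powi (- w r)" using q_nonzero by (simp add: power_int_minus field_simps)
    then show ?thesis by simp
  qed simp
  then show ?thesis
    unfolding pow_eq[OF gen_carrier] KK_eq KI_eq mat_diag_mult_left[OF X] mat_diag_mult_right[OF X]
    by (intro eq_matI) simp_all
qed


section \<open>The R-matrix\<close>

sublocale W: uq_pairing "mat_algebra N" q KK KI EE FF "mat_algebra (N * N)" kron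
proof -
  interpret P: algebra_pairing "mat_algebra N" "mat_algebra N" "mat_algebra (N * N)" kron
    by (rule kron_pairing)
  show "uq_pairing (mat_algebra N) q KK KI EE FF (mat_algebra (N * N)) kron" ..
qed

definition R_coeff :: "nat \<Rightarrow> complex" where
  "R_coeff l = (q - inverse q) ^ l / qfact q l * q ^ (l * (l - 1) div 2)"

text \<open>
  Division by \<open>[l]!\<close> is harmless for \<open>l < N\<close>.
\<close>

lemma qint_nonzero: 
  assumes "0 < n" "n < N" shows "qint q (int n) \<noteq> 0"
proof
  assume "qint q (int n) = 0"
  then have "q ^ n = inverse (q ^ n)"
    using S.q_minus_inverse by (simp add: qint_def power_int_minus)
  then have "(q ^ n)\<^sup>2 = 1" using q_nonzero by (simp add: field_simps power2_eq_square)
  then have "N dvd n" using q_power_eq_pm1[of n] by (simp add: power2_eq_1_iff)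
  then show False using assms by (auto dest: dvd_imp_le)
qed

lemma R_coeff_Suc:
  assumes "l < N - 1"
  shows "R_coeff (Suc l) * S.comm_coeff l = R_coeff l"
proof -
  define p where "p = inverse q"
  define d where "d = q - p"
  have d: "d \<noteq> 0" using S.q_minus_inverse by (simp add: d_def p_def)
  have qp: "q ^ l * p ^ l = 1" for l using q_nonzero by (simp add: p_def power_inverse)
  define Q where "Q = qint q (int (Suc l))"
  have Q: "Q \<noteq> 0" unfolding Q_def using assms by (intro qint_nonzero) auto
  have "(q ^ Suc l - p ^ Suc l) = Q * d" using d
    by (simp add: Q_def qint_def d_def p_def power_int_minus power_inverse flip: of_nat_Suc power_Suc)
  then have "p ^ l * (Q * d) = q * (q ^ l * p ^ l) - p ^ l * p ^ l * p"
    by (metis (no_types, opaque_lifting) mult.assoc mult.commute power_Suc right_diff_distrib)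
  also have "\<dots> = q - p ^ (2 * l + 1)" unfolding qp by (simp add: mult_2 power_add)
  finally have Qd: "q - p ^ (2 * l + 1) = p ^ l * (Q * d)" ..
  have g: "S.comm_coeff l = p ^ l * Q / d"
    unfolding S.comm_coeff_def p_def[symmetric] d_def[symmetric] Qd using d by (simp add: power2_eq_square)
  have tri: "Suc l * (Suc l - 1) div 2 = l * (l - 1) div 2 + l"
    by (cases l) (simp_all add: algebra_simps)
  have "R_coeff (Suc l) = d * d ^ l / (Q * qfact q l) * (q ^ (l * (l - 1) div 2) * q ^ l)"
    unfolding R_coeff_def tri by (simp add: d_def p_def Q_def power_add)
  then have "R_coeff (Suc l) * S.comm_coeff l
      = d ^ l / qfact q l * q ^ (l * (l - 1) div 2) * (q ^ l * p ^ l)"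
    unfolding g using d Q by (simp add: field_simps)
  then show ?thesis unfolding qp by (simp add: R_coeff_def d_def p_def)
qed

lemma semicyclic_hom: "semicyclic N a i \<in> algebra_hom (Uq q) (mat_algebra N)"
  and semicyclic_of_gen: "semicyclic N a i (uq_of_gen q g) = semicyclic_gen N a i g"
proof -
  have "S.gens g = semicyclic_gen N a i g" for g by (cases g) (simp_all add: S.gens_def)
  then have "S.gens = semicyclic_gen N a i" ..
  then show "semicyclic N a i \<in> algebra_hom (Uq q) (mat_algebra N)"
    "semicyclic N a i (uq_of_gen q g) = semicyclic_gen N a i g"
    using S.lift_hom by (simp_all add: semicyclic_def)
qed

lemma R_image_eq: "R_image N a i = R_diag N i * W.quasi_R R_coeff N"
proof -
  have "(\<Oplus>\<^bsub>mat_algebra (N * N)\<^esub> l \<in> {0..<N}. R_coeff l \<cdot>\<^sub>m kron (EE ^\<^sub>m l) (FF ^\<^sub>m l)) = W.quasi_R R_coeff N"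
    unfolding W.quasi_R_def
    by (rule W.P.C.finsum_cong') (auto simp: pow_eq module_mat_simps)
  then show ?thesis by (simp add: R_image_def Let_def semicyclic_of_gen R_coeff_def)
qed

lemma SN: "N = Suc (N - 1)" using N3 by simp

lemma R_image_Unit: "R_image N a i \<in> Units (mat_algebra (N * N))"
proof -
  have "FF [^]\<^bsub>mat_algebra N\<^esub> Suc (N - 1) = \<zero>\<^bsub>mat_algebra N\<^esub>"
    using FF_nilpotent SN by (simp add: module_mat_simps)
  then have "W.quasi_R R_coeff N \<in> Units (mat_algebra (N * N))"
    using W.quasi_R_Unit[of "N - 1" R_coeff] SN by (simp add: R_coeff_def)
  then have "R_diag N i \<otimes>\<^bsub>mat_algebra (N * N)\<^esub> W.quasi_R R_coeff N \<in> Units (mat_algebra (N * N))"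
    by (rule W.P.C.Units_m_closed[OF R_diag_Unit])
  then show ?thesis by (simp add: R_image_eq module_mat_simps)
qed

text \<open>
  If \<open>X\<close> shifts the index by \<open>s\<close>, then conjugating \<open>X\<close> in one tensor factor by \<open>q\<close> to the power
  \<open>H \<otimes> H / 2\<close> produces \<open>K\<^sup>s\<close> in the other factor. The equations turn the intermediate elements of
  \<open>quasi_R_intertwines\<close> into the flipped coproducts.
\<close>

lemma R_diag_conj:
  "R_diag N i * kron (1\<^sub>m N) EE = kron KK EE * R_diag N i"
  "R_diag N i * kron EE KI = kron EE (1\<^sub>m N) * R_diag N i"
  "R_diag N i * kron KK FF = kron (1\<^sub>m N) FF * R_diag N i"
  "R_diag N i * kron FF (1\<^sub>m N) = kron FF KI * R_diag N i"
  "R_diag N i * kron KK KK = kron KK KK * R_diag N i"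
proof -
  have E: "phase r k = q powi w k * phase c k"
    if "EE $$ (r, c) \<noteq> 0" "r < N" "c < N" for r c k
    using gen_shift(1)[OF that(2,3,1)] phase_shift[of r c 1 k] by simp
  have F: "phase r k = q powi (- w k) * phase c k"
    if "FF $$ (r, c) \<noteq> 0" "r < N" "c < N" for r c k
    using gen_shift(2)[OF that(2,3,1)] phase_shift[of r c "-1" k] by (simp del: power_int_minus)
  have E1: "phase k r * EE $$ (r, c) = q powi w k * EE $$ (r, c) * phase k c"
    and E2: "phase r k * (EE $$ (r, c) * q powi (- w k)) = EE $$ (r, c) * phase c k"
    if "r < N" "c < N" for r c k
    using E[OF _ that] q_nonzero
    by (cases "EE $$ (r, c) = 0"; simp add: phase_commute[of k] power_int_minus)+
  have F1: "phase k r * (q powi w k * FF $$ (r, c)) = FF $$ (r, c) * phase k c"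
    and F2: "phase r k * FF $$ (r, c) = FF $$ (r, c) * q powi (- w k) * phase c k"
    if "r < N" "c < N" for r c k
    using F[OF _ that] q_nonzero
    by (cases "FF $$ (r, c) = 0"; simp add: phase_commute[of k] power_int_minus)+
  show "R_diag N i * kron (1\<^sub>m N) EE = kron KK EE * R_diag N i"
  proof (rule R_diag_kron)
    fix r s r' s' assume "r < N" "s < N" "r' < N" "s' < N"
    then show "phase r r' * (1\<^sub>m N $$ (r, s) * EE $$ (r', s')) = KK $$ (r, s) * EE $$ (r', s') * phase s s'"
      using E1[of r' s' s] by (cases "r = s") (simp_all add: KK_eq mat_diag_def)
  qed simp_all
  show "R_diag N i * kron EE KI = kron EE (1\<^sub>m N) * R_diag N i"
  proof (rule R_diag_kron)
    fix r s r' s' assume "r < N" "s < N" "r' < N" "s' < N"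
    then show "phase r r' * (EE $$ (r, s) * KI $$ (r', s')) = EE $$ (r, s) * 1\<^sub>m N $$ (r', s') * phase s s'"
      using E2[of r s s'] by (cases "r' = s'") (simp_all add: KI_eq mat_diag_def)
  qed simp_all
  show "R_diag N i * kron KK FF = kron (1\<^sub>m N) FF * R_diag N i"
  proof (rule R_diag_kron)
    fix r s r' s' assume "r < N" "s < N" "r' < N" "s' < N"
    then show "phase r r' * (KK $$ (r, s) * FF $$ (r', s')) = 1\<^sub>m N $$ (r, s) * FF $$ (r', s') * phase s s'"
      using F1[of r' s' s] by (cases "r = s") (simp_all add: KK_eq mat_diag_def)
  qed simp_all
  show "R_diag N i * kron FF (1\<^sub>m N) = kron FF KI * R_diag N i"
  proof (rule R_diag_kron)
    fix r s r' s' assume "r < N" "s < N" "r' < N" "s' < N"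
    then show "phase r r' * (FF $$ (r, s) * 1\<^sub>m N $$ (r', s')) = FF $$ (r, s) * KI $$ (r', s') * phase s s'"
      using F2[of r s s'] by (cases "r' = s'") (simp_all add: KI_eq mat_diag_def)
  qed simp_all
  show "R_diag N i * kron KK KK = kron KK KK * R_diag N i"
    by (intro R_diag_kron) (auto simp: KK_eq mat_diag_def)
qed


lemma R_image_intertwines:
  "R_image N a i * kron KK KK = kron KK KK * R_image N a i"
  "R_image N a i * (kron EE KK + kron (1\<^sub>m N) EE) = (kron KK EE + kron EE (1\<^sub>m N)) * R_image N a i"
  "R_image N a i * (kron FF (1\<^sub>m N) + kron KI FF) = (kron (1\<^sub>m N) FF + kron FF KI) * R_image N a i"
proof -
  let ?\<Theta> = "W.quasi_R R_coeff N" and ?D = "R_diag N i"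
  have D [simp]: "?D \<in> carrier_mat (N * N) (N * N)" by (simp add: R_diag_eq)
  have T [simp]: "?\<Theta> \<in> carrier_mat (N * N) (N * N)"
    using W.quasi_R_closed[of R_coeff N] by (simp add: module_mat_simps)
  have move: "?D * ?\<Theta> * X = Y * (?D * ?\<Theta>)"
    if "X \<in> carrier_mat (N * N) (N * N)" "X' \<in> carrier_mat (N * N) (N * N)" "Y \<in> carrier_mat (N * N) (N * N)"
      and X: "?\<Theta> * X = X' * ?\<Theta>" and X': "?D * X' = Y * ?D" for X X' Y
  proof -
    have "?D * ?\<Theta> * X = ?D * (?\<Theta> * X)" by (rule assoc_mult_mat[of _ "N * N" "N * N" _ "N * N" _ "N * N"]) (simp_all add: that)
    also have "\<dots> = ?D * X' * ?\<Theta>" unfolding X by (rule assoc_mult_mat[of _ "N * N" "N * N" _ "N * N" _ "N * N", symmetric]) (simp_all add: that)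
    also have "\<dots> = Y * (?D * ?\<Theta>)" unfolding X' by (rule assoc_mult_mat[of _ "N * N" "N * N" _ "N * N" _ "N * N"]) (simp_all add: that)
    finally show ?thesis .
  qed
  have coeff: "R_coeff (Suc l) * S.comm_coeff l = R_coeff l" if "l < N - 1" for l
    using that by (rule R_coeff_Suc)
  have nil: "FF [^]\<^bsub>mat_algebra N\<^esub> Suc (N - 1) = \<zero>\<^bsub>mat_algebra N\<^esub>"
    using FF_nilpotent SN by (simp add: module_mat_simps)
  have top: "FF [^]\<^bsub>mat_algebra N\<^esub> (N - 1) \<otimes>\<^bsub>mat_algebra N\<^esub> KK
      = KI \<otimes>\<^bsub>mat_algebra N\<^esub> FF [^]\<^bsub>mat_algebra N\<^esub> (N - 1)"
    using FF_top by (simp add: module_mat_simps)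
  note \<Theta> = W.quasi_R_intertwines[OF coeff nil top, folded SN, unfolded module_mat_simps]
  have d: "A * (B + C) = A * B + A * C"
    if "A \<in> carrier_mat (N * N) (N * N)" "B \<in> carrier_mat (N * N) (N * N)" "C \<in> carrier_mat (N * N) (N * N)" for A B C :: "complex mat"
    using that by (rule mult_add_distrib_mat)
  have d': "(A + B) * C = A * C + B * C"
    if "A \<in> carrier_mat (N * N) (N * N)" "B \<in> carrier_mat (N * N) (N * N)" "C \<in> carrier_mat (N * N) (N * N)" for A B C :: "complex mat"
    using that by (rule add_mult_distrib_mat)
  show "R_image N a i * kron KK KK = kron KK KK * R_image N a i"
    unfolding R_image_eq
    by (rule move[OF _ _ _ W.quasi_R_K[unfolded module_mat_simps] R_diag_conj(5)]) simp_all
  show "R_image N a i * (kron EE KK + kron (1\<^sub>m N) EE) = (kron KK EE + kron EE (1\<^sub>m N)) * R_image N a i"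
    unfolding R_image_eq by (rule move[OF _ _ _ \<Theta>(1)]) (simp_all add: d d' R_diag_conj)
  show "R_image N a i * (kron FF (1\<^sub>m N) + kron KI FF) = (kron (1\<^sub>m N) FF + kron FF KI) * R_image N a i"
    unfolding R_image_eq comm_add_mat[OF kron_dim[OF one_carrier_mat gen_carrier] kron_dim[OF gen_carrier gen_carrier]]
    by (rule move[OF _ _ _ \<Theta>(2)]) (simp_all add: d d' R_diag_conj)
qed

end

text \<open>
  The coproduct is the instance of \<open>coproduct_elements\<close> for the universal pairing
  \<open>U \<times> U \<rightarrow> U \<otimes> U\<close>.
\<close>

lemma uq_coproduct_hom:
  assumes q: "q \<noteq> 0" "q\<^sup>2 \<noteq> 1"
  shows "uq_coproduct q \<in> algebra_hom (Uq q) (uq_tensor q)"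
    and "uq_coproduct q (uq_of_gen q g) = uq_coproduct_gen q g"
proof -
  interpret U: uq_elements "Uq q" q "uq_of_gen q GenK" "uq_of_gen q GenKinv" "uq_of_gen q GenE" "uq_of_gen q GenF"
    by (rule Uq_elements[OF q])
  interpret P: algebra_pairing "Uq q" "Uq q" "uq_tensor q" "tensor_elem (Uq q) (Uq q)"
    by (rule tensor_elem_pairing; rule Uq_alg)
  interpret W: uq_pairing "Uq q" q "uq_of_gen q GenK" "uq_of_gen q GenKinv" "uq_of_gen q GenE" "uq_of_gen q GenF"
    "uq_tensor q" "tensor_elem (Uq q) (Uq q)" ..
  interpret D: uq_elements "uq_tensor q" q
    "tensor_elem (Uq q) (Uq q) (uq_of_gen q GenK) (uq_of_gen q GenK)"
    "tensor_elem (Uq q) (Uq q) (uq_of_gen q GenKinv) (uq_of_gen q GenKinv)"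
    W.coprod_E W.coprod_F
    by (rule W.coproduct_elements)
  have "D.gens g = uq_coproduct_gen q g" for g
    by (cases g) (simp_all add: D.gens_def uq_coproduct_gen_def Let_def)
  then have "D.gens = uq_coproduct_gen q" ..
  then show "uq_coproduct q \<in> algebra_hom (Uq q) (uq_tensor q)"
    "uq_coproduct q (uq_of_gen q g) = uq_coproduct_gen q g"
    using D.lift_hom by (simp_all add: uq_coproduct_def)
qed

theorem proposition3p1:
  fixes N i :: nat and a :: complex and Z :: uq
  assumes "3 \<le> N" and "odd N" and "a \<noteq> 0" and "i < N"
    and "Z \<in> carrier (Uq (qroot N))"
  shows "R_image N a i \<in> Units (mat_algebra (N * N)) \<and>
    R_image N a i * semicyclic_tensor N a i (uq_coproduct (qroot N) Z)
        * inv\<^bsub>mat_algebra (N * N)\<^esub> R_image N a i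
      = semicyclic_tensor N a i (uq_coproduct_flipped (qroot N) Z)"
proof
  interpret semicyclic_setting N i a using assms by unfold_locales
  let ?q = "qroot N" and ?M = "mat_algebra (N * N)" and ?R = "R_image N a i"
  let ?U = "Uq ?q" and ?T = "tensor_elem (Uq ?q) (Uq ?q)" and ?g = "uq_of_gen ?q"
  interpret U: uq_elements ?U ?q "?g GenK" "?g GenKinv" "?g GenE" "?g GenF"
    by (rule Uq_elements[OF q_nonzero q_power_2])
  show R: "?R \<in> Units ?M" by (rule R_image_Unit)
  have g [simp]: "?g x \<in> carrier ?U" for x by (cases x) simp_all
  interpret T: algebra_pairing ?U ?U "uq_tensor ?q" ?T
    by (rule tensor_elem_pairing; rule Uq_alg)
  interpret F: algebra_pairing ?U ?U "uq_tensor ?q" "\<lambda>x y. ?T y x" by (rule T.flip)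
  interpret V: algebra_pairing ?U ?U ?M "\<lambda>x y. kron (semicyclic N a i x) (semicyclic N a i y)"
    by (rule W.P.pullback[OF Uq_alg(1) Uq_alg(1) semicyclic_hom semicyclic_hom])
  note cop = uq_coproduct_hom[OF q_nonzero q_power_2]
  note V_hom = V.tensor_lift_hom[folded semicyclic_tensor_def]
  note V_elem = V.tensor_lift_elem[folded semicyclic_tensor_def]
  note F_hom = F.tensor_lift_hom[folded tensor_flip_def]
  note F_elem = F.tensor_lift_elem[folded tensor_flip_def]
  note homs = algebra_hom_simps[OF V_hom] algebra_hom_simps[OF F_hom]
  define h where "h Z = ?R \<otimes>\<^bsub>?M\<^esub> semicyclic_tensor N a i (uq_coproduct ?q Z) \<otimes>\<^bsub>?M\<^esub> inv\<^bsub>?M\<^esub> ?R" for Z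
  define h' where "h' Z = semicyclic_tensor N a i (uq_coproduct_flipped ?q Z)" for Z
  have h: "h \<in> algebra_hom ?U ?M"
    using algebra_hom_compose[OF algebra_hom_compose[OF cop(1) V_hom] W.P.C.conjugation_algebra_hom[OF R]]
    by (simp add: h_def[abs_def])
  have h': "h' \<in> algebra_hom ?U ?M"
    using algebra_hom_compose[OF algebra_hom_compose[OF cop(1) F_hom] V_hom]
    by (simp add: h'_def[abs_def] uq_coproduct_flipped_def)
  have one: "semicyclic N a i \<one>\<^bsub>?U\<^esub> = 1\<^sub>m N"
    using algebra_hom_one[OF semicyclic_hom] by (simp add: module_mat_simps)
  have conj: "h x = y" if "semicyclic_tensor N a i (uq_coproduct ?q x) = X" "?R * X = y * ?R"
    "X \<in> carrier ?M" "y \<in> carrier ?M" for x X y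
  proof -
    have "h x = y \<otimes>\<^bsub>?M\<^esub> ?R \<otimes>\<^bsub>?M\<^esub> inv\<^bsub>?M\<^esub> ?R"
      using that by (simp add: h_def module_mat_simps)
    also have "\<dots> = y" using R that(4) by (simp add: W.P.C.m_assoc W.P.C.Units_closed W.P.C.Units_r_inv)
    finally show ?thesis .
  qed
  have gen: "h (?g x) = h' (?g x)" if "x \<noteq> GenKinv" for x
  proof (rule conj[OF refl])
    note s = h'_def uq_coproduct_flipped_def cop(2) uq_coproduct_gen_def Let_def homs V_elem F_elem
      semicyclic_of_gen one
    show "?R * semicyclic_tensor N a i (uq_coproduct ?q (?g x)) = h' (?g x) * ?R"
      using that R_image_intertwines
      by (cases x) (simp_all add: s, simp_all add: module_mat_simps)
    show "h' (?g x) \<in> carrier ?M" using algebra_hom_closed[OF h'] by simp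
    show "semicyclic_tensor N a i (uq_coproduct ?q (?g x)) \<in> carrier ?M"
      using algebra_hom_closed[OF algebra_hom_compose[OF cop(1) V_hom]] by simp
  qed
  have "h (?g x) = h' (?g x)" for x
  proof (cases "x = GenKinv")
    case True
    \<comment> \<open>A homomorphism takes the inverse of \<open>K\<close> to an inverse, so this generator follows from \<open>K\<close>.\<close>
    have inv: "f (?g GenKinv) = inv\<^bsub>?M\<^esub> (f (?g GenK))" if f: "f \<in> algebra_hom ?U ?M" for f
    proof (rule W.P.C.inv_unique'[of "f (?g GenK)" "f (?g GenKinv)"])
      show "f (?g GenK) \<otimes>\<^bsub>?M\<^esub> f (?g GenKinv) = \<one>\<^bsub>?M\<^esub>" "f (?g GenKinv) \<otimes>\<^bsub>?M\<^esub> f (?g GenK) = \<one>\<^bsub>?M\<^esub>"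
        using algebra_hom_mult[OF f, symmetric] algebra_hom_one[OF f] U.K_Ki U.Ki_K by simp_all
    qed (use algebra_hom_closed[OF f] in simp_all)
    show ?thesis unfolding True inv[OF h] inv[OF h'] using gen[of GenK] by simp
  qed (rule gen)
  from algebra_hom_Uq_eqI[OF mat_alg h h' this assms(5)]
  show "?R * semicyclic_tensor N a i (uq_coproduct ?q Z) * inv\<^bsub>?M\<^esub> ?R
      = semicyclic_tensor N a i (uq_coproduct_flipped ?q Z)"
    by (simp add: h_def h'_def module_mat_simps)
qed

end
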